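(* Let $d,t$ be positive integers with $d\geq 2$ and $d\geq 2t-1$, and let $G=(V,E,L)$ be a weakly $2t$-balanced looped simple graph. Let $F\subset E\cup L$ with $|F|\leq t$. Then $G^{[d-t]}-F$ is $\mathcal{L}_d$-rigid (i.e. $d$-rigid as a linearly constrained framework).
   Context: A looped simple graph $G=(V,E,L)$ has vertex set $V$, a set $E$ of simple edges (no multiple edges) and a set $L$ of loops (a vertex may carry several loops). For $T\subseteq V$, $G-T$ is obtained by deleting the vertices of $T$ together with all edges and loops incident to them; for $F\subseteq E\cup L$, $G-F$ deletes the members of $F$. $G$ is weakly $k$-balanced if for every $T\subseteq V$ with $|T|\leq k$, every connected component of $G-T$ contains at least $k-|T|$ loops. For an integer $s\geq 0$, $G^{[s]}$ is the looped simple graph obtained from $G$ by adding $s$ new loops at every vertex. A linearly constrained framework $(G,p,q)$ in $\mathbb{R}^d$ consists of $G$, $p:V\to\mathbb{R}^d$ and $q:L\to\mathbb{R}^d$. Its rigidity matrix $R_d(G,p,q)$ is the $(|E|+|L|)\times d|V|$ matrix whose row for an edge $v_iv_j$ has $p(v_i)-p(v_j)$ in the $d$ columns of $v_i$, $p(v_j)-p(v_i)$ in the $d$ columns of $v_j$ and zeros elsewhere, and whose row for a loop $e$ at $v_i$ has $q(e)$ in the $d$ columns of $v_i$ and zeros elsewhere. $(p,q)$ is generic if the set of all coordinates of $p$ and $q$ is algebraically independent over $\mathbb{Q}$. The linearly constrained rigidity matroid $\mathcal{R}^{lc}_d(G)$ is the matroid on $E\cup L$ in which a set is independent iff the corresponding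 rows of $R_d(G,p,q)$ are linearly independent for a generic $(p,q)$ (this does not depend on the generic choice); $r^{lc}_d$ denotes its rank function. $G$ is $\mathcal{L}_d$-rigid if $r^{lc}_d(E\cup L)=d|V|$. *)

theory Defs
  imports Complex_Main "HOL-Library.Poly_Mapping"
begin

section \<open>Looped simple graphs\<close>

text \<open>
  A simple edge is the two-element set of its ends. Loops are abstract objects carrying an
  attachment vertex, so that a vertex may carry several of them.
\<close>

record ('v, 'l) looped_graph =
  verts :: "'v set"
  edges :: "'v set set"
  loops :: "'l set"
  base :: "'l \<Rightarrow> 'v"

definition looped_simple_graph :: "('v, 'l) looped_graph \<Rightarrow> bool" where
  "looped_simple_graph G \<longleftrightarrow>
     finite (verts G) \<and> finite (loops G) \<and>
     (\<forall>e\<in>edges G. e \<subseteq> verts G \<and> card e = 2) \<and>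
     (\<forall>l\<in>loops G. base G l \<in> verts G)"

datatype ('v, 'l) elt = Edge "'v set" | Loop 'l

definition elts :: "('v, 'l) looped_graph \<Rightarrow> ('v, 'l) elt set" where
  "elts G = Edge ` edges G \<union> Loop ` loops G"

definition del_verts :: "('v, 'l) looped_graph \<Rightarrow> 'v set \<Rightarrow> ('v, 'l) looped_graph" where
  "del_verts G T = \<lparr>verts = verts G - T, edges = {e \<in> edges G. e \<inter> T = {}},
     loops = {l \<in> loops G. base G l \<notin> T}, base = base G\<rparr>"

definition del_elts :: "('v, 'l) looped_graph \<Rightarrow> ('v, 'l) elt set \<Rightarrow> ('v, 'l) looped_graph" where
  "del_elts G F = \<lparr>verts = verts G, edges = {e \<in> edges G. Edge e \<notin> F},
     loops = {l \<in> loops G. Loop l \<notin> F}, base = base G\<rparr>"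

text \<open>
  The loops of \<open>add_loops s G\<close> are the old loops \<open>Inl l\<close> and the new loops \<open>Inr (v, j)\<close> at \<open>v\<close>
  for \<open>j < s\<close>. An element \<open>x\<close> of \<open>G\<close> becomes the element \<open>map_elt Inl x\<close> of \<open>add_loops s G\<close>.
\<close>

definition add_loops :: "nat \<Rightarrow> ('v, 'l) looped_graph \<Rightarrow> ('v, 'l + 'v \<times> nat) looped_graph" where
  "add_loops s G = \<lparr>verts = verts G, edges = edges G,
     loops = loops G <+> (verts G \<times> {..<s}), base = case_sum (base G) fst\<rparr>"

definition connected_rel :: "('v, 'l) looped_graph \<Rightarrow> ('v \<times> 'v) set" where
  "connected_rel G = {(u, v) \<in> verts G \<times> verts G. (u, v) \<in> {(a, b). {a, b} \<in> edges G}\<^sup>*}"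

definition components :: "('v, 'l) looped_graph \<Rightarrow> 'v set set" where
  "components G = verts G // connected_rel G"

definition weakly_balanced :: "nat \<Rightarrow> ('v, 'l) looped_graph \<Rightarrow> bool" where
  "weakly_balanced k G \<longleftrightarrow>
     (\<forall>T \<subseteq> verts G. card T \<le> k \<longrightarrow>
        (\<forall>C \<in> components (del_verts G T).
           k - card T \<le> card {l \<in> loops (del_verts G T). base (del_verts G T) l \<in> C}))"

section \<open>Algebraic independence over the rationals\<close>

text \<open>
  A polynomial over the rationals in variables indexed by \<open>'i\<close> is a finitely supported map from
  monomials (finitely supported exponent maps) to coefficients.
\<close>

definition rat_poly_eval :: "('i \<Rightarrow> real) \<Rightarrow> (('i \<Rightarrow>\<^sub>0 nat) \<Rightarrow>\<^sub>0 rat) \<Rightarrow> real" where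
  "rat_poly_eval x P =
     (\<Sum>m \<in> Poly_Mapping.keys P. of_rat (Poly_Mapping.lookup P m) *
        (\<Prod>i \<in> Poly_Mapping.keys m. x i ^ Poly_Mapping.lookup m i))"

text \<open>Independence of the family \<open>(x i)\<close>, \<open>i \<in> I\<close>; in particular its members are distinct.\<close>

definition alg_independent :: "'i set \<Rightarrow> ('i \<Rightarrow> real) \<Rightarrow> bool" where
  "alg_independent I x \<longleftrightarrow>
     (\<forall>P. P \<noteq> 0 \<and> (\<forall>m \<in> Poly_Mapping.keys P. Poly_Mapping.keys m \<subseteq> I) \<longrightarrow> rat_poly_eval x P \<noteq> 0)"

section \<open>Linearly constrained frameworks\<close>

text \<open>
  Vectors of \<open>d\<close>-space are functions on \<open>nat\<close> of which only the coordinates \<open>i < d\<close> are used.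
  The columns of the rigidity matrix are indexed by pairs \<open>(v, i)\<close> of a vertex and such a coordinate.
\<close>

definition generic ::
  "nat \<Rightarrow> ('v, 'l) looped_graph \<Rightarrow> ('v \<Rightarrow> nat \<Rightarrow> real) \<Rightarrow> ('l \<Rightarrow> nat \<Rightarrow> real) \<Rightarrow> bool" where
  "generic d G p q \<longleftrightarrow>
     alg_independent ((verts G <+> loops G) \<times> {..<d}) (\<lambda>(a, i). case_sum p q a i)"

fun rigidity_matrix ::
  "('v, 'l) looped_graph \<Rightarrow> ('v \<Rightarrow> nat \<Rightarrow> real) \<Rightarrow> ('l \<Rightarrow> nat \<Rightarrow> real) \<Rightarrow>
   ('v, 'l) elt \<Rightarrow> 'v \<times> nat \<Rightarrow> real" where
  "rigidity_matrix G p q (Edge e) (v, i) =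
     (if v \<in> e then p v i - p (THE w. e = {v, w}) i else 0)"
| "rigidity_matrix G p q (Loop l) (v, i) = (if v = base G l then q l i else 0)"

definition rows_independent ::
  "nat \<Rightarrow> ('v, 'l) looped_graph \<Rightarrow> ('v \<Rightarrow> nat \<Rightarrow> real) \<Rightarrow> ('l \<Rightarrow> nat \<Rightarrow> real) \<Rightarrow>
   ('v, 'l) elt set \<Rightarrow> bool" where
  "rows_independent d G p q X \<longleftrightarrow>
     (\<forall>c. (\<forall>j \<in> verts G \<times> {..<d}. (\<Sum>x\<in>X. c x * rigidity_matrix G p q x j) = 0) \<longrightarrow>
          (\<forall>x\<in>X. c x = 0))"

text \<open>
  Independence of rows is the same for all generic \<open>(p, q)\<close>, and generic \<open>(p, q)\<close> exist for every
  finite graph, so the existential quantifier could equally be universal.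
\<close>

definition lc_indep :: "nat \<Rightarrow> ('v, 'l) looped_graph \<Rightarrow> ('v, 'l) elt set \<Rightarrow> bool" where
  "lc_indep d G X \<longleftrightarrow>
     X \<subseteq> elts G \<and> (\<exists>p q. generic d G p q \<and> rows_independent d G p q X)"

definition lc_rank :: "nat \<Rightarrow> ('v, 'l) looped_graph \<Rightarrow> ('v, 'l) elt set \<Rightarrow> nat" where
  "lc_rank d G A = Max {card X | X. X \<subseteq> A \<and> lc_indep d G X}"

definition lc_rigid :: "nat \<Rightarrow> ('v, 'l) looped_graph \<Rightarrow> bool" where
  "lc_rigid d G \<longleftrightarrow> lc_rank d G (elts G) = d * card (verts G)"

end

theory Submission
  imports Defs "HOL-Library.Function_Algebras" "HOL-Library.Transitive_Closure_Table"
    "HOL-Computational_Algebra.Polynomial" "HOL-Analysis.Continuum_Not_Denumerable"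
    "HOL-Analysis.Finite_Cartesian_Product"
begin

text \<open>
  Independence of rows is an open condition and generic frameworks are dense, so one framework of
  full rank suffices. Adding \<open>s = d - t\<close> free vectors at each vertex produces full rank as soon as,
  for every \<open>X \<subseteq> V\<close>, the rows of \<open>G - F\<close> have rank at least \<open>t |X|\<close> once the vertices outside \<open>X\<close>
  are pinned (principal extension of a matroid).

  Contract the complement of \<open>X\<close> to a root and read a loop as an edge to the root. Weak \<open>2t\<close>-balance says that this
  multigraph is \<open>2t\<close>-edge-connected, so, as in the Nash-Williams--Tutte count, it can be oriented
  after removal of the at most \<open>t\<close> elements of \<open>F\<close> such that every vertex has indegree at least
  \<open>t\<close> and is reachable from the root. Keep \<open>t\<close> incoming elements per vertex, among them those of a
  spanning arborescence. If every vertex of a nonempty set \<open>X'\<close> met at least \<open>2t\<close> of the kept elements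
  lying in \<open>X'\<close>, these would exhaust the \<open>t |X'|\<close> elements pointing into \<open>X'\<close>, and no arc of the
  arborescence could enter \<open>X'\<close>. So there always is a vertex meeting at most \<open>2t - 1 \<le> d\<close> of them, and
  the rows of the kept elements are independent for points on the moment curve.
\<close>

section \<open>Orientations rooted outside a vertex set\<close>

text \<open>Grow the reached set from the empty one: by \<open>cut\<close> some element meets the
  unreached part \<open>X - R\<close> in a single vertex \<open>u\<close>, so its other end, if any,
  is reached, and \<open>u\<close> can be added with that element as its arc. The predicate
  \<open>good\<close> restricts the admissible heads; it is instantiated once by arbitrary ends and
  once by the heads of a given orientation.\<close>

lemma arborescence_exists:
  fixes X :: "'v set" and ends :: "'e \<Rightarrow> 'v set"
  assumes fin: "finite X"
    and ends: "\<And>e. e \<in> Z \<Longrightarrow> ends e \<subseteq> X"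
    and cut: "\<And>U. U \<subseteq> X \<Longrightarrow> U \<noteq> {} \<Longrightarrow> \<exists>e\<in>Z. \<exists>u. good e u \<and> ends e \<inter> U = {u}"
  obtains B h where "B \<subseteq> Z" "\<And>e. e \<in> B \<Longrightarrow> good e (h e)" "inj_on h B"
    "\<And>P. P \<subseteq> X \<Longrightarrow> P \<noteq> {} \<Longrightarrow> \<exists>e\<in>B. ends e \<inter> P = {h e}"
proof -
  define T where "T R B h \<longleftrightarrow> B \<subseteq> Z \<and> (\<forall>e\<in>B. good e (h e) \<and> ends e \<subseteq> R \<and> h e \<in> R) \<and> inj_on h B \<and>
    (\<forall>P\<subseteq>R. P \<noteq> {} \<longrightarrow> (\<exists>e\<in>B. ends e \<inter> P = {h e}))" for R B h
  have "\<exists>R\<subseteq>X. card R = n \<and> (\<exists>B h. T R B h)" if "n \<le> card X" for n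
    using that
  proof (induction n)
    case 0
    have "T {} {} h" for h by (auto simp: T_def)
    then show ?case by (metis card.empty empty_subsetI)
  next
    case (Suc n)
    then obtain R B h where R: "R \<subseteq> X" "card R = n" and T: "T R B h" using Suc_leD by blast
    have "X - R \<noteq> {}" using R Suc.prems by auto
    then obtain e u where e: "e \<in> Z" "good e u" "ends e \<inter> (X - R) = {u}"
      using cut[of "X - R"] by blast
    have u: "u \<in> X" "u \<notin> R" "u \<in> ends e" using e by auto
    have eB: "e \<notin> B" using T u by (auto simp: T_def)
    have ends_e: "ends e \<subseteq> insert u R" using e ends by blast
    have "T (insert u R) (insert e B) (h(e := u))"
      unfolding T_def
    proof (intro conjI ballI allI impI)
      show "insert e B \<subseteq> Z" using e T by (auto simp: T_def)
      show "inj_on (h(e := u)) (insert e B)" using T eB u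
        unfolding T_def inj_on_def by auto
    next
      fix e' assume "e' \<in> insert e B"
      then show "good e' ((h(e := u)) e')" "ends e' \<subseteq> insert u R" "(h(e := u)) e' \<in> insert u R"
        using T e ends_e unfolding T_def by auto
    next
      fix P assume P: "P \<subseteq> insert u R" "P \<noteq> {}"
      show "\<exists>e'\<in>insert e B. ends e' \<inter> P = {(h(e := u)) e'}"
      proof (cases "P \<inter> R = {}")
        case True
        then have "P = {u}" using P by auto
        then show ?thesis using u by auto
      next
        \<comment> \<open>The arc entering \<open>P \<inter> R\<close> has all its ends in
          \<open>R\<close>, hence misses the new vertex and enters \<open>P\<close> as well.\<close>
        case False
        then obtain e' where e': "e' \<in> B" "ends e' \<inter> (P \<inter> R) = {h e'}"
          using T unfolding T_def by (metis inf_le2)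
        moreover have "ends e' \<subseteq> R" using e' T unfolding T_def by auto
        ultimately have "ends e' \<inter> P = {(h(e := u)) e'}" using eB by auto
        then show ?thesis using e' by blast
      qed
    qed
    moreover have "card (insert u R) = Suc n" using u R fin by (metis card_insert_disjoint finite_subset)
    moreover have "insert u R \<subseteq> X" using R u by auto
    ultimately show ?case by blast
  qed
  from this[of "card X"] obtain R B h where "R \<subseteq> X" "card R = card X" "T R B h" by blast
  moreover have "R = X" using calculation fin by (simp add: card_subset_eq)
  ultimately have T: "T X B h" by simp
  show thesis
  proof (rule that[of B h])
    show "B \<subseteq> Z" "inj_on h B" using T by (simp_all add: T_def)
    show "good e (h e)" if "e \<in> B" for e using T that by (simp add: T_def)
    show "\<exists>e\<in>B. ends e \<inter> P = {h e}" if "P \<subseteq> X" "P \<noteq> {}" for P using T that by (simp add: T_def)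
  qed
qed

lemma rtranclp_crossing:
  assumes "r\<^sup>*\<^sup>* v s" "v \<notin> P" "s \<in> P"
  obtains x y where "r\<^sup>*\<^sup>* v x" "r x y" "x \<notin> P" "y \<in> P"
  using assms by (induction rule: rtranclp_induct) auto

section \<open>Orientations with large indegrees, by path reversal\<close>

text \<open>An element with a single end is a half-edge attached to the root, which is not a vertex.\<close>

locale half_edge_graph =
  fixes X :: "'v set" and Z :: "'e set" and ends :: "'e \<Rightarrow> 'v set"
  assumes finite_X: "finite X" and finite_Z: "finite Z"
    and ends_subset: "e \<in> Z \<Longrightarrow> ends e \<subseteq> X"
    and ends_nonempty: "e \<in> Z \<Longrightarrow> ends e \<noteq> {}"
    and card_ends: "e \<in> Z \<Longrightarrow> card (ends e) \<le> 2"
begin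

definition orientation :: "('e \<Rightarrow> 'v) \<Rightarrow> bool" where
  "orientation h \<longleftrightarrow> (\<forall>e\<in>Z. h e \<in> ends e)"

text \<open>For an orientation these are the elements with head in \<open>P\<close> and tail
  outside, the tail of a half-edge being the root.\<close>

definition into :: "('e \<Rightarrow> 'v) \<Rightarrow> 'v set \<Rightarrow> 'e set" where
  "into h P = {e \<in> Z. ends e \<inter> P = {h e}}"

text \<open>Only elements with two ends give steps, so a path never runs through the root.\<close>

definition step :: "('e \<Rightarrow> 'v) \<Rightarrow> 'v \<Rightarrow> 'v \<Rightarrow> bool" where
  "step h v w \<longleftrightarrow> v \<noteq> w \<and> (\<exists>e\<in>Z. ends e = {v, w} \<and> h e = w)"

lemma finite_ends: "e \<in> Z \<Longrightarrow> finite (ends e)"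
  using ends_subset finite_X finite_subset by blast

lemma finite_into [simp]: "finite (into h P)"
  unfolding into_def using finite_Z by auto

lemma into_singleton: "orientation h \<Longrightarrow> into h {v} = {e \<in> Z. h e = v}"
  unfolding into_def orientation_def by auto

lemma ends_cases:
  assumes "e \<in> Z" "x \<in> ends e"
  obtains "ends e = {x}" | y where "y \<noteq> x" "ends e = {x, y}"
proof -
  have "card (ends e - {x}) \<le> 1" using card_ends[OF assms(1)] finite_ends[OF assms(1)] assms by auto
  then have "ends e - {x} = {} \<or> (\<exists>y. ends e - {x} = {y})"
    using finite_ends[OF assms(1)] by (metis card_0_eq card_1_singletonE finite_Diff le_neq_implies_less less_one)
  then show thesis using that assms by blast
qed

text \<open>An element entering \<open>P \<inter> Q\<close> has its tail outside \<open>P\<close> or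
  outside \<open>Q\<close> and so enters one of them; an element entering both the intersection and
  the union enters both sets.\<close>

lemma into_submodular:
  assumes "orientation h"
  shows "card (into h (P \<inter> Q)) + card (into h (P \<union> Q)) \<le> card (into h P) + card (into h Q)"
proof -
  have 1: "into h (P \<inter> Q) \<subseteq> into h P \<union> into h Q"
  proof
    fix e assume e: "e \<in> into h (P \<inter> Q)"
    then have "e \<in> Z" "h e \<in> ends e" by (auto simp: into_def)
    then show "e \<in> into h P \<union> into h Q"
      by (rule ends_cases) (use e in \<open>auto simp: into_def\<close>)
  qed
  have 2: "into h (P \<union> Q) \<subseteq> into h P \<union> into h Q" by (auto simp: into_def)
  have 3: "into h (P \<inter> Q) \<inter> into h (P \<union> Q) \<subseteq> into h P \<inter> into h Q" by (auto simp: into_def)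
  have "card (into h (P \<inter> Q)) + card (into h (P \<union> Q)) =
      card (into h (P \<inter> Q) \<union> into h (P \<union> Q)) + card (into h (P \<inter> Q) \<inter> into h (P \<union> Q))"
    by (intro card_Un_Int) auto
  also have "\<dots> \<le> card (into h P \<union> into h Q) + card (into h P \<inter> into h Q)"
    using 1 2 3 by (intro add_mono card_mono) auto
  also have "\<dots> = card (into h P) + card (into h Q)"
    by (intro card_Un_Int[symmetric]) auto
  finally show ?thesis .
qed

text \<open>The contributions of consecutive arcs telescope, so only the two ends of the path change
  the indegree of a set. The clause on untouched elements serves the induction: by distinctness the
  first arc is not affected by reversing the rest and still points to \<open>w\<close>.\<close>

lemma reverse_path:
  assumes "rtrancl_path (step h) v xs s" "distinct (v # xs)" "orientation h"
  shows "\<exists>h'. orientation h' \<and>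
      (\<forall>P. card (into h' P) + of_bool (s \<in> P) = card (into h P) + of_bool (v \<in> P)) \<and>
      (\<forall>e\<in>Z. \<not> ends e \<subseteq> set (v # xs) \<longrightarrow> h' e = h e)"
  using assms
proof (induction rule: rtrancl_path.induct)
  case (base x)
  then show ?case by auto
next
  case (step v w ys s)
  then obtain h1 where h1: "orientation h1"
    "\<And>P. card (into h1 P) + of_bool (s \<in> P) = card (into h P) + of_bool (w \<in> P)"
    "\<And>e. e\<in>Z \<Longrightarrow> \<not> ends e \<subseteq> set (w # ys) \<Longrightarrow> h1 e = h e" by auto
  obtain e where e: "v \<noteq> w" "e \<in> Z" "ends e = {v, w}" "h e = w"
    using step.hyps(1) unfolding step_def by auto
  have he: "h1 e = w" using h1(3)[of e] e step.prems by auto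
  define h' where "h' = h1(e := v)"
  have "orientation h'" using h1(1) e unfolding orientation_def h'_def by auto
  moreover have "card (into h' P) + of_bool (s \<in> P) = card (into h P) + of_bool (v \<in> P)" for P
  proof -
    \<comment> \<open>\<open>C\<close> collects the elements other than \<open>e\<close> entering
      \<open>P\<close>; reversing \<open>e\<close> leaves it unchanged, so the two indegrees differ
      only by the membership of \<open>e\<close>.\<close>
    define C where "C = into h1 P - {e}"
    have C: "finite C" "e \<notin> C" unfolding C_def by auto
    have "e \<in> into h1 P \<longleftrightarrow> w \<in> P \<and> v \<notin> P"
      using e he by (auto simp: into_def)
    then have "into h1 P = (if w \<in> P \<and> v \<notin> P then insert e C else C)"
      unfolding C_def by auto
    moreover have "e \<in> into h' P \<longleftrightarrow> v \<in> P \<and> w \<notin> P"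
      using e by (auto simp: into_def h'_def)
    moreover have "into h' P - {e} = C"
      unfolding C_def into_def h'_def by auto
    then have "into h' P = (if e \<in> into h' P then insert e C else C)" by auto
    ultimately have "card (into h' P) + of_bool (w \<in> P) = card (into h1 P) + of_bool (v \<in> P)"
      using C by auto
    then show ?thesis using h1(2)[of P] by linarith
  qed
  moreover have "h' e' = h e'" if "e' \<in> Z" "\<not> ends e' \<subseteq> set (v # w # ys)" for e'
    using that h1(3)[of e'] e unfolding h'_def by auto
  ultimately show ?case by (intro exI[of _ h']) auto
qed

text \<open>Among the orientations entering every nonempty set, take one that maximizes the sum of
  the indegrees capped at \<open>t\<close>. If a vertex were still deficient, path reversals could
  fail only because of sets entered once, and these lead to a family violating
  \<open>cross\<close>.\<close>

theorem rooted_orientation: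
  assumes t: "1 \<le> t"
    and cross: "\<And>\<P>. \<P> \<noteq> {} \<Longrightarrow> (\<And>P. P \<in> \<P> \<Longrightarrow> P \<subseteq> X \<and> P \<noteq> {}) \<Longrightarrow> pairwise disjnt \<P> \<Longrightarrow>
      t * card \<P> \<le> card {e \<in> Z. \<exists>P\<in>\<P>. card (ends e \<inter> P) = 1}"
  obtains h where "orientation h" "\<And>v. v \<in> X \<Longrightarrow> t \<le> card (into h {v})"
    "\<And>P. P \<subseteq> X \<Longrightarrow> P \<noteq> {} \<Longrightarrow> into h P \<noteq> {}"
proof -
  define feasible where "feasible h \<longleftrightarrow> orientation h \<and> (\<forall>P\<subseteq>X. P \<noteq> {} \<longrightarrow> into h P \<noteq> {})" for h
  \<comment> \<open>Capping at \<open>t\<close> makes surplus indegree worthless, so moving one unit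
    from a surplus vertex to a deficient one strictly increases the sum.\<close>
  define \<Phi> where "\<Phi> h = (\<Sum>v\<in>X. min t (card (into h {v})))" for h
  \<comment> \<open>A one-member family in \<open>cross\<close> gives an element crossing each
    nonempty set, which is all that an arborescence requires. Its arcs keep every nonempty set
    entered, whatever the heads of the other elements.\<close>
  have "\<exists>e\<in>Z. \<exists>u. u \<in> ends e \<and> ends e \<inter> U = {u}" if "U \<subseteq> X" "U \<noteq> {}" for U
  proof -
    have "t \<le> card {e \<in> Z. card (ends e \<inter> U) = 1}"
      using cross[of "{U}"] that by simp
    then have "{e \<in> Z. card (ends e \<inter> U) = 1} \<noteq> {}" using t by (metis card.empty le_zero_eq not_one_le_zero)
    then show ?thesis by (auto simp: card_1_singleton_iff)
  qed
  then obtain B h0 where B: "B \<subseteq> Z" "\<And>e. e \<in> B \<Longrightarrow> h0 e \<in> ends e"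
    "\<And>P. P \<subseteq> X \<Longrightarrow> P \<noteq> {} \<Longrightarrow> \<exists>e\<in>B. ends e \<inter> P = {h0 e}"
    using arborescence_exists[OF finite_X, of Z ends "\<lambda>e u. u \<in> ends e"] ends_subset by metis
  have feasible0: "feasible (\<lambda>e. if e \<in> B then h0 e else SOME u. u \<in> ends e)"
    unfolding feasible_def
  proof (intro conjI allI impI)
    show "orientation (\<lambda>e. if e \<in> B then h0 e else SOME u. u \<in> ends e)"
      unfolding orientation_def using B(2) ends_nonempty by (auto simp: some_in_eq)
  next
    fix P assume "P \<subseteq> X" "P \<noteq> {}"
    then obtain e where "e \<in> B" "ends e \<inter> P = {h0 e}" using B(3) by blast
    then have "e \<in> into (\<lambda>e. if e \<in> B then h0 e else SOME u. u \<in> ends e) P"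
      using B(1) by (auto simp: into_def)
    then show "into (\<lambda>e. if e \<in> B then h0 e else SOME u. u \<in> ends e) P \<noteq> {}" by blast
  qed
  have \<Phi>_le: "\<Phi> h \<le> t * card X" for h
  proof -
    have "\<Phi> h \<le> of_nat (card X) * t"
      unfolding \<Phi>_def by (rule sum_bounded_above) (rule min.cobounded1)
    then show ?thesis by (simp add: mult.commute)
  qed
  have "\<exists>h. feasible h \<and> (\<forall>h'. feasible h' \<longrightarrow> \<Phi> h' \<le> \<Phi> h)"
    by (rule ex_has_greatest_nat[of feasible, OF feasible0, of \<Phi> "Suc (t * card X)"]) (simp add: \<Phi>_le less_Suc_eq_le)
  then obtain h where feas: "feasible h" and max: "\<And>h'. feasible h' \<Longrightarrow> \<Phi> h' \<le> \<Phi> h"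
    by blast
  have h: "orientation h" using feas by (simp add: feasible_def)
  have entered: "into h P \<noteq> {}" if "P \<subseteq> X" "P \<noteq> {}" for P
    using feas that by (simp add: feasible_def)
  have "t \<le> card (into h {v})" if v: "v \<in> X" for v
  proof (rule ccontr)
    assume "\<not> t \<le> card (into h {v})"
    then have deficit: "card (into h {v}) < t" by simp
    \<comment> \<open>The vertices reachable from \<open>v\<close>; no arc leads out of
      \<open>S\<close>.\<close>
    define S where "S = {s. (step h)\<^sup>*\<^sup>* v s}"
    have step_closed: "y \<in> S" if "x \<in> S" "step h x y" for x y
      using that unfolding S_def by (simp add: rtranclp.rtrancl_into_rtrancl)
    have vS: "v \<in> S" by (simp add: S_def)
    have S_sub: "S \<subseteq> X"
    proof
      fix s assume "s \<in> S"
      then have "(step h)\<^sup>*\<^sup>* v s" by (simp add: S_def)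
      then show "s \<in> X"
        by (induction rule: rtranclp_induct) (use v ends_subset in \<open>auto simp: step_def\<close>)
    qed
    then have finS: "finite S" using finite_X finite_subset by blast
    \<comment> \<open>Reversing a path from \<open>v\<close> to a surplus vertex \<open>s\<close> would increase \<open>\<Phi>\<close>, so a set with a single
      entering element separates \<open>s\<close> from \<open>v\<close>. The maximal such sets partition \<open>S\<close> into parts that
      together receive too few elements.\<close>
    define tight where "tight P \<longleftrightarrow> P \<subseteq> S \<and> v \<notin> P \<and> P \<noteq> {} \<and> card (into h P) = 1" for P
    have tight_ex: "\<exists>P. tight P \<and> s \<in> P" if s: "s \<in> S" "t < card (into h {s})" for s
    proof -
      have sv: "s \<noteq> v" using deficit s by auto
      have reach: "(step h)\<^sup>*\<^sup>* v s" using s by (simp add: S_def)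
      then obtain xs where "rtrancl_path (step h) v xs s" "distinct (v # xs)"
        by (metis rtranclp_eq_rtrancl_path rtrancl_path_distinct)
      then obtain h' where h': "orientation h'"
        "\<And>P. card (into h' P) + of_bool (s \<in> P) = card (into h P) + of_bool (v \<in> P)"
        using reverse_path h by metis
      have eq: "card (into h' {x}) + of_bool (s = x) = card (into h {x}) + of_bool (v = x)" for x
        using h'(2)[of "{x}"] by simp
      \<comment> \<open>\<open>v\<close> was below \<open>t\<close> and \<open>s\<close> above it,
        so the gain at \<open>v\<close> counts and the loss at \<open>s\<close> does not.\<close>
      have "\<Phi> h < \<Phi> h'"
        unfolding \<Phi>_def
      proof (rule sum_strict_mono_ex1)
        show "\<forall>x\<in>X. min t (card (into h {x})) \<le> min t (card (into h' {x}))"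
        proof
          fix x
          show "min t (card (into h {x})) \<le> min t (card (into h' {x}))"
            using eq[of x] s sv by (cases "s = x"; cases "v = x") auto
        qed
        show "\<exists>x\<in>X. min t (card (into h {x})) < min t (card (into h' {x}))"
          using eq[of v] sv deficit v by (intro bexI[of _ v]) auto
      qed (use finite_X in auto)
      \<comment> \<open>By maximality some set \<open>P\<close> is no longer entered; the balance of
        indegrees then forces \<open>s \<in> P\<close>, \<open>v \<notin> P\<close> and a single
        entering element before the reversal.\<close>
      then have "\<not> feasible h'" using max[of h'] by auto
      then obtain P where P: "P \<subseteq> X" "P \<noteq> {}" "into h' P = {}"
        using h'(1) unfolding feasible_def by blast
      have "card (into h P) \<noteq> 0" using entered[OF P(1,2)] by simp
      moreover have "of_bool (s \<in> P) = card (into h P) + of_bool (v \<in> P)"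
        using h'(2)[of P] unfolding P(3) by simp
      ultimately have "s \<in> P \<and> v \<notin> P \<and> card (into h P) = 1"
        by (cases "s \<in> P"; cases "v \<in> P") simp_all
      then have sP: "s \<in> P" and vP: "v \<notin> P" and card1: "card (into h P) = 1" by blast+
      obtain e where e: "into h P = {e}" using card1 by (auto simp: card_1_singleton_iff)
      \<comment> \<open>A path from \<open>v\<close> to \<open>s\<close> crosses into
        \<open>P\<close>, so the unique element entering \<open>P\<close> is an arc of it and has
        its head in \<open>S\<close>.\<close>
      obtain x y where xy: "(step h)\<^sup>*\<^sup>* v x" "step h x y" "x \<notin> P" "y \<in> P"
        using rtranclp_crossing[OF reach vP sP] .
      then obtain e0 where e0: "e0 \<in> Z" "ends e0 = {x, y}" "h e0 = y" by (auto simp: step_def)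
      have "e0 \<in> into h P" using e0 xy by (auto simp: into_def)
      then have heS: "h e \<in> S" using e e0 xy step_closed[of x y] by (auto simp: S_def)
      have "P \<subseteq> S"
      proof (rule ccontr)
        assume "\<not> P \<subseteq> S"
        \<comment> \<open>An element entering \<open>P - S\<close> cannot have its tail in
          \<open>S\<close>, as no arc leaves \<open>S\<close>; hence it enters \<open>P\<close> and
          equals \<open>e\<close>, whose head lies in \<open>S\<close>.\<close>
        then obtain e' where e': "e' \<in> into h (P - S)" using entered[of "P - S"] P by blast
        then have e'Z: "e' \<in> Z" "h e' \<in> ends e'" "h e' \<in> P" "h e' \<notin> S" by (auto simp: into_def)
        have "ends e' \<inter> P = {h e'}"
          using e'Z(1,2)
        proof (rule ends_cases)
          fix z assume z: "z \<noteq> h e'" "ends e' = {h e', z}"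
          have "z \<notin> S" using step_closed[of z "h e'"] e'Z z by (auto simp: step_def insert_commute)
          then have "z \<notin> P" using e' z by (auto simp: into_def)
          then show ?thesis using z e'Z by auto
        qed (use e'Z in auto)
        then have "e' = e" using e e'Z by (auto simp: into_def)
        then show False using heS e'Z by simp
      qed
      then show ?thesis using sP vP card1 unfolding tight_def by blast
    qed
    \<comment> \<open>Intersection and union are each entered at least once and together at most
      twice, so each is entered exactly once.\<close>
    have tight_Un: "tight (P \<union> Q)" if PQ: "tight P" "tight Q" "P \<inter> Q \<noteq> {}" for P Q
    proof -
      have sub: "P \<inter> Q \<subseteq> X" "P \<union> Q \<subseteq> X" using PQ S_sub by (auto simp: tight_def)
      have "card (into h (P \<inter> Q)) \<noteq> 0" "card (into h (P \<union> Q)) \<noteq> 0"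
        using entered[of "P \<inter> Q"] entered[of "P \<union> Q"] sub PQ(3) by auto
      moreover have "card (into h (P \<inter> Q)) + card (into h (P \<union> Q)) \<le> 2"
        using into_submodular[OF h, of P Q] PQ by (auto simp: tight_def)
      ultimately have "card (into h (P \<union> Q)) = 1" by linarith
      then show ?thesis using PQ unfolding tight_def by blast
    qed
    have tight_Union: "tight (\<Union>\<F>)" if "finite \<F>" "\<F> \<noteq> {}" "\<forall>P\<in>\<F>. tight P \<and> s \<in> P" for \<F> s
      using that
    proof (induction rule: finite_ne_induct)
      case (insert P \<F>)
      then have "s \<in> P" "s \<in> \<Union>\<F>" "tight P" "tight (\<Union>\<F>)" by auto
      then show ?case using tight_Un[of P "\<Union>\<F>"] by auto
    qed auto
    \<comment> \<open>Inserting \<open>s\<close> makes a singleton part of a vertex lying in no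
      tight set; otherwise \<open>M s\<close> is the largest tight set containing
      \<open>s\<close>.\<close>
    define M where "M s = insert s (\<Union>{P. tight P \<and> s \<in> P})" for s
    have M_tight: "tight (M s)" if "tight P" "s \<in> P" for s P
    proof -
      have "finite {P. tight P \<and> s \<in> P}"
        by (rule finite_subset[of _ "Pow S"]) (use finS in \<open>auto simp: tight_def\<close>)
      then have "tight (\<Union>{P. tight P \<and> s \<in> P})" using that by (intro tight_Union) auto
      moreover have "M s = \<Union>{P. tight P \<and> s \<in> P}" using that by (auto simp: M_def)
      ultimately show ?thesis by simp
    qed
    have M_self: "s \<in> M s" for s by (simp add: M_def)
    have M_sub: "P \<subseteq> M s" if "tight P" "s \<in> P" for s P using that by (auto simp: M_def)
    have M_eq: "M x = M s" if "x \<in> M s" for x s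
    proof (cases "x = s")
      case False
      then obtain P where P: "tight P" "s \<in> P" "x \<in> P" using \<open>x \<in> M s\<close> by (auto simp: M_def)
      then have "M s \<subseteq> M x" using M_tight[of P s] M_sub that by blast
      moreover have "M x \<subseteq> M s" using M_tight[of P x] M_sub[of P x] M_sub[of "M x" s] P by blast
      ultimately show ?thesis by blast
    qed simp
    have M_small: "M s = {s}" if "\<nexists>P. tight P \<and> s \<in> P" for s
      using that by (auto simp: M_def)
    have Mv: "M v = {v}" by (rule M_small) (auto simp: tight_def)
    have MS: "M s \<subseteq> S" if "s \<in> S" for s using that by (auto simp: M_def tight_def)
    define \<P> where "\<P> = M ` S"
    have fin\<P>: "finite \<P>" using finS by (simp add: \<P>_def)
    have part_eq: "Q = M x" if "Q \<in> \<P>" "x \<in> Q" for Q x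
      using that M_eq by (auto simp: \<P>_def)
    \<comment> \<open>A tight part is entered once and \<open>1 \<le> t\<close>; a singleton part
      outside all tight sets has indegree at most \<open>t\<close> by
      \<open>tight_ex\<close>.\<close>
    have small: "card (into h Q) \<le> t" if "Q \<in> \<P>" for Q
    proof -
      obtain s where s: "s \<in> S" "Q = M s" using \<open>Q \<in> \<P>\<close> by (auto simp: \<P>_def)
      show ?thesis
      proof (cases "\<exists>P. tight P \<and> s \<in> P")
        case True
        then have "tight Q" using M_tight s by blast
        then show ?thesis using t by (simp add: tight_def)
      next
        case False
        then show ?thesis using M_small s tight_ex by (metis not_le)
      qed
    qed
    have "t * card \<P> \<le> card {e \<in> Z. \<exists>P\<in>\<P>. card (ends e \<inter> P) = 1}"
    proof (rule cross)
      show "\<P> \<noteq> {}" using vS by (auto simp: \<P>_def)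
      show "P \<subseteq> X \<and> P \<noteq> {}" if "P \<in> \<P>" for P
        using that MS S_sub M_self unfolding \<P>_def by blast
      show "pairwise disjnt \<P>"
        unfolding pairwise_def disjnt_def using part_eq by blast
    qed
    \<comment> \<open>An element crossing a part \<open>Q\<close> has its head in \<open>S\<close>,
      because no arc leaves \<open>S\<close>, and it enters the part of its head: with both ends in
      that part, the part would be \<open>Q\<close>, which contains only one end.\<close>
    also have "\<dots> \<le> card (\<Union>P\<in>\<P>. into h P)"
    proof (rule card_mono)
      show "finite (\<Union>P\<in>\<P>. into h P)" using fin\<P> by auto
      show "{e \<in> Z. \<exists>P\<in>\<P>. card (ends e \<inter> P) = 1} \<subseteq> (\<Union>P\<in>\<P>. into h P)"
      proof
        fix e assume "e \<in> {e \<in> Z. \<exists>P\<in>\<P>. card (ends e \<inter> P) = 1}"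
        then obtain Q x where e: "e \<in> Z" "Q \<in> \<P>" "ends e \<inter> Q = {x}"
          by (auto simp: card_1_singleton_iff)
        have xS: "x \<in> S" using e MS by (auto simp: \<P>_def)
        have he: "h e \<in> ends e" using h e by (auto simp: orientation_def)
        have x: "x \<in> ends e" using e by auto
        have hS: "h e \<in> S"
          using e(1) x
        proof (rule ends_cases)
          fix y assume "y \<noteq> x" "ends e = {x, y}"
          then show ?thesis using he xS step_closed[of x y] e by (auto simp: step_def)
        qed (use he xS in auto)
        have "ends e \<inter> M (h e) = {h e}"
          using e(1) he
        proof (rule ends_cases)
          fix y assume y: "y \<noteq> h e" "ends e = {h e, y}"
          have "y \<notin> M (h e)"
          proof
            assume "y \<in> M (h e)"
            then have "ends e \<subseteq> M (h e)" using y M_self by auto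
            moreover have "Q = M (h e)" using part_eq[OF e(2)] M_eq calculation x e by blast
            ultimately show False using e y by auto
          qed
          then show ?thesis using y M_self by auto
        qed (use M_self in auto)
        then have "e \<in> into h (M (h e))" using e by (auto simp: into_def)
        then show "e \<in> (\<Union>P\<in>\<P>. into h P)" using hS by (auto simp: \<P>_def)
      qed
    qed
    also have "\<dots> \<le> (\<Sum>P\<in>\<P>. card (into h P))" by (rule card_UN_le[OF fin\<P>])
    \<comment> \<open>Strictness comes from the part \<open>{v}\<close>, whose indegree is below
      \<open>t\<close>.\<close>
    also have "\<dots> < (\<Sum>P\<in>\<P>. t)"
    proof (rule sum_strict_mono_ex1[OF fin\<P>])
      show "\<exists>P\<in>\<P>. card (into h P) < t"
        using vS Mv deficit unfolding \<P>_def by (intro bexI[of _ "{v}"]) auto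
    qed (use small in auto)
    finally show False by (simp add: mult.commute)
  qed
  then show thesis using that h entered by blast
qed

text \<open>The kept elements are \<open>t\<close> per head and include a spanning arborescence. A
  set \<open>X'\<close> with all inner degrees at least \<open>2 * t\<close> would need every one of
  the \<open>t * card X'\<close> kept elements pointing into it to have two ends inside, but the
  arborescence supplies one that enters \<open>X'\<close>.\<close>

theorem degenerate_selection:
  assumes t: "1 \<le> t"
    and cross: "\<And>\<P>. \<P> \<noteq> {} \<Longrightarrow> (\<And>P. P \<in> \<P> \<Longrightarrow> P \<subseteq> X \<and> P \<noteq> {}) \<Longrightarrow> pairwise disjnt \<P> \<Longrightarrow>
      t * card \<P> \<le> card {e \<in> Z. \<exists>P\<in>\<P>. card (ends e \<inter> P) = 1}"
  obtains Z' where "Z' \<subseteq> Z" "card Z' = t * card X"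
    "\<And>X'. X' \<subseteq> X \<Longrightarrow> X' \<noteq> {} \<Longrightarrow> \<exists>v\<in>X'. card {e \<in> Z'. v \<in> ends e \<and> ends e \<subseteq> X'} < 2 * t"
proof -
  obtain h where h: "orientation h" "\<And>v. v \<in> X \<Longrightarrow> t \<le> card (into h {v})"
    "\<And>P. P \<subseteq> X \<Longrightarrow> P \<noteq> {} \<Longrightarrow> into h P \<noteq> {}"
    using rooted_orientation[OF t cross] by blast
  have hX: "h e \<in> X" if "e \<in> Z" for e
    using h(1) that ends_subset by (auto simp: orientation_def)
  have cut: "\<exists>e\<in>Z. \<exists>u. u = h e \<and> ends e \<inter> U = {u}" if "U \<subseteq> X" "U \<noteq> {}" for U
    using h(3)[OF that] by (auto simp: into_def)
  obtain B h' where B: "B \<subseteq> Z" "\<And>e. e \<in> B \<Longrightarrow> h' e = h e" "inj_on h' B"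
    "\<And>P. P \<subseteq> X \<Longrightarrow> P \<noteq> {} \<Longrightarrow> \<exists>e\<in>B. ends e \<inter> P = {h' e}"
    by (rule arborescence_exists[OF finite_X ends_subset cut]) auto
  have injB: "inj_on h B" using B(2,3) by (simp add: inj_on_def)
  \<comment> \<open>Injectivity of \<open>h\<close> on \<open>B\<close> means at most one
    arborescence arc per head, so it fits among the \<open>t\<close> elements kept at
    \<open>v\<close>.\<close>
  have "\<exists>A. {e \<in> B. h e = v} \<subseteq> A \<and> A \<subseteq> {e \<in> Z. h e = v} \<and> card A = t" if v: "v \<in> X" for v
  proof (rule exists_subset_between)
    have "card {e \<in> B. h e = v} \<le> card {v}"
      by (rule card_inj_on_le[of h]) (use injB in \<open>auto intro: inj_on_subset\<close>)
    then show "card {e \<in> B. h e = v} \<le> t" using t by simp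
    show "t \<le> card {e \<in> Z. h e = v}" using h(2)[OF v] into_singleton[OF h(1)] by simp
  qed (use B(1) finite_Z in auto)
  then have "\<exists>A. \<forall>v\<in>X. {e \<in> B. h e = v} \<subseteq> A v \<and> A v \<subseteq> {e \<in> Z. h e = v} \<and> card (A v) = t"
    by (intro bchoice) blast
  then obtain A where "\<forall>v\<in>X. {e \<in> B. h e = v} \<subseteq> A v \<and> A v \<subseteq> {e \<in> Z. h e = v} \<and> card (A v) = t"
    by (rule exE)
  then have A: "\<And>v. v \<in> X \<Longrightarrow> {e \<in> B. h e = v} \<subseteq> A v"
    "\<And>v. v \<in> X \<Longrightarrow> A v \<subseteq> {e \<in> Z. h e = v}" "\<And>v. v \<in> X \<Longrightarrow> card (A v) = t" by simp_all
  have cardA: "card (\<Union>v\<in>Y. A v) = t * card Y" if "Y \<subseteq> X" for Y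
  proof -
    have "card (\<Union>v\<in>Y. A v) = (\<Sum>v\<in>Y. card (A v))"
    proof (rule card_UN_disjoint)
      show "finite Y" using that finite_X finite_subset by blast
      show "\<forall>v\<in>Y. finite (A v)" using A(2) that finite_Z by (metis (no_types, lifting) finite_subset mem_Collect_eq subsetD subsetI)
      show "\<forall>i\<in>Y. \<forall>j\<in>Y. i \<noteq> j \<longrightarrow> A i \<inter> A j = {}" using A(2) that by blast
    qed
    also have "\<dots> = (\<Sum>v\<in>Y. t)" using A(3) that by (intro sum.cong) auto
    finally show ?thesis by (simp add: mult.commute)
  qed
  define Z' where "Z' = (\<Union>v\<in>X. A v)"
  have Z'Z: "Z' \<subseteq> Z" using A(2) unfolding Z'_def by blast
  then have finZ': "finite Z'" using finite_Z finite_subset by blast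
  have BZ': "B \<subseteq> Z'"
  proof
    fix e assume e: "e \<in> B"
    then have "h e \<in> X" using hX B(1) by blast
    then show "e \<in> Z'" unfolding Z'_def using A(1)[of "h e"] e by blast
  qed
  show thesis
  proof (rule that)
    show "Z' \<subseteq> Z" by (rule Z'Z)
    show "card Z' = t * card X" unfolding Z'_def by (rule cardA) simp
    fix X' assume X': "X' \<subseteq> X" "X' \<noteq> {}"
    show "\<exists>v\<in>X'. card {e \<in> Z'. v \<in> ends e \<and> ends e \<subseteq> X'} < 2 * t"
    proof (rule ccontr)
      assume "\<not> ?thesis"
      then have big: "2 * t \<le> card {e \<in> Z'. v \<in> ends e \<and> ends e \<subseteq> X'}" if "v \<in> X'" for v
        using that by (auto simp: not_less)
      \<comment> \<open>\<open>W\<close> holds the kept elements inside \<open>X'\<close>,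
        \<open>W'\<close> those with head in \<open>X'\<close>. Heads are ends, so
        \<open>W \<subseteq> W'\<close>, and \<open>W'\<close> has \<open>t * card X'\<close>
        elements.\<close>
      define W where "W = {e \<in> Z'. ends e \<subseteq> X'}"
      define W' where "W' = (\<Union>v\<in>X'. A v)"
      have finW: "finite W" using finZ' by (simp add: W_def)
      have finX': "finite X'" using X'(1) finite_X finite_subset by blast
      have W'Z: "W' \<subseteq> Z'" using X'(1) by (auto simp: W'_def Z'_def)
      have W'_iff: "e \<in> W' \<longleftrightarrow> h e \<in> X'" if "e \<in> Z'" for e
      proof -
        obtain v where v: "v \<in> X" "e \<in> A v" using \<open>e \<in> Z'\<close> by (auto simp: Z'_def)
        then have hv: "h e = v" using A(2) by blast
        show ?thesis
        proof
          assume "e \<in> W'"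
          then obtain w where "w \<in> X'" "e \<in> A w" by (auto simp: W'_def)
          then show "h e \<in> X'" using A(2) X'(1) by blast
        qed (use hv v in \<open>auto simp: W'_def\<close>)
      qed
      have WW': "W \<subseteq> W'"
      proof
        fix e assume e: "e \<in> W"
        then have "e \<in> Z" using Z'Z by (auto simp: W_def)
        then have "h e \<in> ends e" using h(1) by (auto simp: orientation_def)
        then show "e \<in> W'" using W'_iff e by (auto simp: W_def)
      qed
      obtain b where b: "b \<in> B" "ends b \<inter> X' = {h b}" using B(2,4) X' by metis
      have bW': "b \<in> W'" using b BZ' W'_iff by auto
      have finW': "finite W'" using W'Z finZ' finite_subset by blast
      have "2 * t * card X' \<le> (\<Sum>v\<in>X'. card {e \<in> Z'. v \<in> ends e \<and> ends e \<subseteq> X'})"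
        using sum_bounded_below[of X' "2 * t" "\<lambda>v. card {e \<in> Z'. v \<in> ends e \<and> ends e \<subseteq> X'}"] big
        by (simp add: mult.commute)
      also have "\<dots> = (\<Sum>v\<in>X'. \<Sum>e\<in>W. of_bool (v \<in> ends e))"
      proof (rule sum.cong[OF refl])
        fix v
        have "{e \<in> Z'. v \<in> ends e \<and> ends e \<subseteq> X'} = W \<inter> {e. v \<in> ends e}" by (auto simp: W_def)
        then show "card {e \<in> Z'. v \<in> ends e \<and> ends e \<subseteq> X'} = (\<Sum>e\<in>W. of_bool (v \<in> ends e))"
          using finW by (simp add: sum_of_bool_eq)
      qed
      also have "\<dots> = (\<Sum>e\<in>W. card (ends e))"
      proof (subst sum.swap, rule sum.cong[OF refl])
        fix e assume "e \<in> W"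
        then have "X' \<inter> {v. v \<in> ends e} = ends e" by (auto simp: W_def)
        then show "(\<Sum>v\<in>X'. of_bool (v \<in> ends e)) = card (ends e)"
          using finX' by (simp add: sum_of_bool_eq)
      qed
      also have "\<dots> < 2 * card W'"
      \<comment> \<open>If the entering arc \<open>b\<close> lies inside \<open>X'\<close>, it is a
        half-edge with one end; otherwise it shows that \<open>W\<close> is a proper subset of
        \<open>W'\<close>.\<close>
      proof (cases "b \<in> W")
        case True
        have "(\<Sum>e\<in>W. card (ends e)) < (\<Sum>e\<in>W. 2)"
        proof (rule sum_strict_mono_ex1[OF finW])
          show "\<forall>e\<in>W. card (ends e) \<le> 2" using card_ends Z'Z by (auto simp: W_def)
          have "ends b = {h b}" using b True by (auto simp: W_def)
          then show "\<exists>e\<in>W. card (ends e) < 2" using True by (intro bexI[of _ b]) auto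
        qed
        also have "\<dots> \<le> 2 * card W'" using card_mono[OF finW' WW'] by simp
        finally show ?thesis .
      next
        case False
        have "(\<Sum>e\<in>W. card (ends e)) \<le> of_nat (card W) * 2"
          by (rule sum_bounded_above) (use card_ends Z'Z in \<open>auto simp: W_def\<close>)
        moreover have "card W < card W'"
          using False bW' WW' finW' by (intro psubset_card_mono) auto
        ultimately show ?thesis by simp
      qed
      finally show False using cardA[OF X'(1)] by (simp add: W'_def)
    qed
  qed
qed

end

section \<open>Weakly balanced graphs\<close>

text \<open>The extra cut \<open>\<Union>\<P>\<close> stands for the side of the root. An element
  with one end in \<open>\<Union>\<P>\<close> crosses at most one member besides the union; one with
  two ends there crosses at most two members and not the union. So each crossing element is counted
  at most twice.\<close>

lemma cross_count:
  fixes ends :: "'e \<Rightarrow> 'v set"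
  assumes fin: "finite Z" "finite \<P>" and disj: "pairwise disjnt \<P>"
    and ends: "\<And>e. e \<in> Z \<Longrightarrow> finite (ends e)" "\<And>e. e \<in> Z \<Longrightarrow> card (ends e) \<le> 2"
    and cut: "\<And>P. P \<in> insert (\<Union>\<P>) \<P> \<Longrightarrow> k \<le> card {e \<in> Z. card (ends e \<inter> P) = 1}"
  shows "k * (card \<P> + 1) \<le> 2 * card {e \<in> Z. \<exists>P\<in>\<P>. card (ends e \<inter> P) = 1}"
proof -
  define K where "K = {e \<in> Z. \<exists>P\<in>\<P>. card (ends e \<inter> P) = 1}"
  define S where "S = \<Union>\<P>"
  define a where "a e = card {P \<in> \<P>. card (ends e \<inter> P) = 1}" for e
  have \<delta>: "card {e \<in> Z. card (ends e \<inter> P) = 1} = (\<Sum>e\<in>Z. of_bool (card (ends e \<inter> P) = 1))" for P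
    using fin by (simp add: sum_of_bool_eq Int_def)
  have "k * (card \<P> + 1) \<le> (\<Sum>P\<in>\<P>. card {e \<in> Z. card (ends e \<inter> P) = 1}) + card {e \<in> Z. card (ends e \<inter> S) = 1}"
    using sum_bounded_below[of \<P> k "\<lambda>P. card {e \<in> Z. card (ends e \<inter> P) = 1}"] cut[of S] cut
    by (simp add: algebra_simps S_def add_mono)
  also have "\<dots> = (\<Sum>e\<in>Z. a e + of_bool (card (ends e \<inter> S) = 1))"
    unfolding \<delta> sum.distrib a_def using fin
    by (subst sum.swap) (simp add: sum_of_bool_eq Int_def)
  also have "\<dots> \<le> (\<Sum>e\<in>Z. 2 * of_bool (e \<in> K))"
  proof (rule sum_mono)
    fix e assume e: "e \<in> Z"
    \<comment> \<open>The members crossed by \<open>e\<close> are pairwise disjoint and contain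
      exactly one end of \<open>e\<close> each, so mapping a member to this end is
      injective.\<close>
    have "a e \<le> card (ends e \<inter> S)"
      unfolding a_def
    proof (rule card_inj_on_le)
      let ?f = "\<lambda>P. SOME x. x \<in> ends e \<inter> P"
      have f: "?f P \<in> ends e \<inter> P" if "card (ends e \<inter> P) = 1" for P
        using that by (metis card.empty some_in_eq zero_neq_one)
      show "inj_on ?f {P \<in> \<P>. card (ends e \<inter> P) = 1}"
      proof (rule inj_onI)
        fix P Q assume P: "P \<in> {P \<in> \<P>. card (ends e \<inter> P) = 1}" and Q: "Q \<in> {P \<in> \<P>. card (ends e \<inter> P) = 1}"
          and eq: "?f P = ?f Q"
        have "?f P \<in> P" "?f P \<in> Q" using f[of P] f[of Q] P Q eq by auto
        then show "P = Q" using P Q disj unfolding pairwise_def disjnt_def by blast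
      qed
      show "?f ` {P \<in> \<P>. card (ends e \<inter> P) = 1} \<subseteq> ends e \<inter> S"
      proof
        fix y assume "y \<in> ?f ` {P \<in> \<P>. card (ends e \<inter> P) = 1}"
        then obtain P where "P \<in> \<P>" "card (ends e \<inter> P) = 1" "y = ?f P" by auto
        then show "y \<in> ends e \<inter> S" using f[of P] unfolding S_def by blast
      qed
    qed (use ends e in auto)
    moreover have "card (ends e \<inter> S) \<le> 2"
      using ends[OF e] by (meson card_mono inf_le1 order_trans)
    moreover have "a e = 0 \<and> card (ends e \<inter> S) \<noteq> 1" if "e \<notin> K"
    proof
      have none: "{P \<in> \<P>. card (ends e \<inter> P) = 1} = {}" using that e by (auto simp: K_def)
      show "a e = 0" unfolding a_def none by simp
      show "card (ends e \<inter> S) \<noteq> 1"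
      proof
        assume "card (ends e \<inter> S) = 1"
        then obtain x where x: "ends e \<inter> S = {x}" by (auto simp: card_1_singleton_iff)
        then obtain P where P: "P \<in> \<P>" "x \<in> P" by (auto simp: S_def)
        have "ends e \<inter> P = {x}" using x P by (auto simp: S_def)
        then show False using none P by auto
      qed
    qed
    ultimately show "a e + of_bool (card (ends e \<inter> S) = 1) \<le> 2 * of_bool (e \<in> K)"
      by (cases "e \<in> K"; cases "card (ends e \<inter> S) = 1") auto
  qed
  also have "\<dots> = 2 * card K"
    using fin by (simp add: sum_distrib_left[symmetric] sum_of_bool_eq K_def Int_def conj_commute)
  finally show ?thesis by (simp add: K_def)
qed

text \<open>A loop gets a single end, so it looks like an edge to the root, just as the trace on
  \<open>X\<close> of an edge with one end outside \<open>X\<close> does.\<close>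

fun elt_ends :: "('v, 'l) looped_graph \<Rightarrow> ('v, 'l) elt \<Rightarrow> 'v set" where
  "elt_ends G (Edge e) = e"
| "elt_ends G (Loop l) = {base G l}"

lemma finite_elts:
  assumes "looped_simple_graph G"
  shows "finite (elts G)"
proof -
  have "edges G \<subseteq> Pow (verts G)" using assms by (auto simp: looped_simple_graph_def)
  then have "finite (edges G)"
    using assms by (meson finite_Pow_iff finite_subset looped_simple_graph_def)
  then show ?thesis using assms by (auto simp: elts_def looped_simple_graph_def)
qed

lemma elt_ends_props:
  assumes "looped_simple_graph G" "x \<in> elts G"
  shows "elt_ends G x \<subseteq> verts G" "card (elt_ends G x) \<le> 2" "finite (elt_ends G x)"
proof -
  show "elt_ends G x \<subseteq> verts G" "card (elt_ends G x) \<le> 2"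
    using assms by (auto simp: elts_def looped_simple_graph_def)
  show "finite (elt_ends G x)" 
    using assms by (auto simp: elts_def looped_simple_graph_def dest: finite_subset)
qed

text \<open>Delete the set \<open>T\<close> of outer neighbours of \<open>P\<close>. Each vertex of
  \<open>T\<close> yields its own edge leaving \<open>P\<close>, and a component of the rest that
  starts in \<open>P\<close> stays in \<open>P\<close>, so balance yields \<open>k - card T\<close>
  loops at \<open>P\<close>. Should \<open>T\<close> have more than \<open>k\<close> vertices, the
  edges alone suffice.\<close>

lemma weakly_balanced_boundary:
  fixes G :: "('v, 'l) looped_graph"
  assumes G: "looped_simple_graph G" and bal: "weakly_balanced k G"
    and P: "P \<subseteq> verts G" "P \<noteq> {}"
  shows "k \<le> card {x \<in> elts G. card (elt_ends G x \<inter> P) = 1}" (is "_ \<le> card ?\<delta>")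
proof -
  define T where "T = {u \<in> verts G - P. \<exists>v\<in>P. {u, v} \<in> edges G}"
  define D where "D = {l \<in> loops G. base G l \<in> P}"
  have finV: "finite (verts G)" and finL: "finite (loops G)" 
    using G by (auto simp: looped_simple_graph_def)
  have finT: "finite T" using finV by (simp add: T_def)
  have fin\<delta>: "finite ?\<delta>" using finite_elts[OF G] by auto
  have "\<forall>u\<in>T. \<exists>v. v \<in> P \<and> {u, v} \<in> edges G" by (auto simp: T_def)
  then obtain f where f: "\<forall>u\<in>T. f u \<in> P \<and> {u, f u} \<in> edges G" by metis
  define g :: "'v \<Rightarrow> ('v, 'l) elt" where "g u = Edge {u, f u}" for u
  have inj: "inj_on g T"
  proof (rule inj_onI)
    fix u u' assume u: "u \<in> T" "u' \<in> T" "g u = g u'"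
    then have "{u, f u} = {u', f u'}" by (simp add: g_def)
    moreover have "u \<notin> P" "f u' \<in> P" using u f by (auto simp: T_def)
    ultimately show "u = u'" by (auto simp: doubleton_eq_iff)
  qed
  have g\<delta>: "g ` T \<subseteq> ?\<delta>"
  proof
    fix x assume "x \<in> g ` T"
    then obtain u where u: "u \<in> T" "x = Edge {u, f u}" by (auto simp: g_def)
    then have "{u, f u} \<inter> P = {f u}" using f by (auto simp: T_def)
    then show "x \<in> ?\<delta>" using u f by (auto simp: elts_def)
  qed
  have L\<delta>: "Loop ` D \<subseteq> ?\<delta>" by (auto simp: D_def elts_def)
  have "card T + card D = card (g ` T) + card (Loop ` D :: ('v, 'l) elt set)"
    using inj by (simp add: card_image inj_on_def)
  also have "\<dots> = card (g ` T \<union> Loop ` D)"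
    using finT finL by (intro card_Un_disjoint[symmetric]) (auto simp: g_def D_def)
  also have "\<dots> \<le> card ?\<delta>" using g\<delta> L\<delta> fin\<delta> by (intro card_mono) auto
  finally have TD: "card T + card D \<le> card ?\<delta>" .
  show ?thesis
  proof (cases "card T \<le> k")
    case True
    obtain v where v: "v \<in> P" using P by auto
    define G' where "G' = del_verts G T"
    define C where "C = connected_rel G' `` {v}"
    have vG': "v \<in> verts G'" using v P by (auto simp: G'_def del_verts_def T_def)
    then have "C \<in> components G'" unfolding C_def components_def by (rule quotientI)
    moreover have "T \<subseteq> verts G" by (auto simp: T_def)
    ultimately have "k - card T \<le> card {l \<in> loops G'. base G' l \<in> C}"
      using bal True unfolding weakly_balanced_def G'_def by blast
    also have "\<dots> \<le> card D"
    proof (rule card_mono)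
      show "finite D" using finL by (simp add: D_def)
      \<comment> \<open>A walk avoiding \<open>T\<close> that starts in \<open>P\<close> cannot
        leave \<open>P\<close>, as the first vertex outside would belong to
        \<open>T\<close>.\<close>
      have "w \<in> P" if "(v, w) \<in> {(a, b). {a, b} \<in> edges G'}\<^sup>*" for w
        using that
      proof (induction rule: rtrancl_induct)
        case (step a b)
        then have ab: "{a, b} \<in> edges G" "b \<notin> T" by (auto simp: G'_def del_verts_def)
        then have "b \<in> verts G" using G unfolding looped_simple_graph_def by blast
        then show ?case using ab step.IH by (auto simp: T_def insert_commute)
      qed (rule v)
      then have "C \<subseteq> P" by (auto simp: C_def connected_rel_def)
      then show "{l \<in> loops G'. base G' l \<in> C} \<subseteq> D"
        by (auto simp: G'_def del_verts_def D_def)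
    qed
    finally show ?thesis using TD by simp
  qed (use TD in simp)
qed

text \<open>With cuts of size \<open>2 * t\<close>, \<open>cross_count\<close> gives at least
  \<open>t * (card \<P> + 1)\<close> crossing elements. Removing \<open>F\<close> destroys at most
  \<open>t\<close> of them, and the remaining \<open>t * card \<P>\<close> are what
  \<open>degenerate_selection\<close> asks for.\<close>

theorem pinned_selection:
  assumes G: "looped_simple_graph G" and bal: "weakly_balanced (2 * t) G" and t: "1 \<le> t"
    and F: "F \<subseteq> elts G" "card F \<le> t" and X: "X \<subseteq> verts G"
  obtains Z where "Z \<subseteq> elts G - F" "card Z = t * card X" "\<And>x. x \<in> Z \<Longrightarrow> elt_ends G x \<inter> X \<noteq> {}"
    "\<And>X'. X' \<subseteq> X \<Longrightarrow> X' \<noteq> {} \<Longrightarrow> \<exists>v\<in>X'. card {x \<in> Z. v \<in> elt_ends G x \<and> elt_ends G x \<inter> X \<subseteq> X'} < 2 * t"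
proof -
  define Z0 where "Z0 = {x \<in> elts G - F. elt_ends G x \<inter> X \<noteq> {}}"
  have finX: "finite X" using X G finite_subset by (auto simp: looped_simple_graph_def)
  have finF: "finite F" using F(1) finite_elts[OF G] finite_subset by blast
  have finZ0: "finite Z0" using finite_elts[OF G] by (simp add: Z0_def)
  \<comment> \<open>Intersecting the ends with \<open>X\<close> contracts the vertices outside
    \<open>X\<close> into the root.\<close>
  interpret H: half_edge_graph X Z0 "\<lambda>x. elt_ends G x \<inter> X"
  proof
    fix x assume "x \<in> Z0"
    then have x: "x \<in> elts G" "elt_ends G x \<inter> X \<noteq> {}" by (auto simp: Z0_def)
    then show "elt_ends G x \<inter> X \<noteq> {}" by simp
    have "card (elt_ends G x \<inter> X) \<le> card (elt_ends G x)"
      using elt_ends_props[OF G x(1)] by (intro card_mono) auto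
    then show "card (elt_ends G x \<inter> X) \<le> 2" using elt_ends_props[OF G x(1)] by simp
  qed (use finX finZ0 in auto)
  have cross: "t * card \<P> \<le> card {x \<in> Z0. \<exists>P\<in>\<P>. card (elt_ends G x \<inter> X \<inter> P) = 1}"
    if \<P>: "\<P> \<noteq> {}" "\<And>P. P \<in> \<P> \<Longrightarrow> P \<subseteq> X \<and> P \<noteq> {}" "pairwise disjnt \<P>" for \<P>
  proof -
    define K where "K = {x \<in> elts G. \<exists>P\<in>\<P>. card (elt_ends G x \<inter> P) = 1}"
    define K0 where "K0 = {x \<in> Z0. \<exists>P\<in>\<P>. card (elt_ends G x \<inter> X \<inter> P) = 1}"
    have "finite \<P>" by (rule finite_subset[of _ "Pow X"]) (use \<P>(2) finX in auto)
    then have "2 * t * (card \<P> + 1) \<le> 2 * card K"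
      unfolding K_def
    proof (rule cross_count[OF finite_elts[OF G] _ \<P>(3)])
      fix P assume "P \<in> insert (\<Union>\<P>) \<P>"
      then have "P \<subseteq> verts G" "P \<noteq> {}" using \<P>(1,2) X by blast+
      then show "2 * t \<le> card {x \<in> elts G. card (elt_ends G x \<inter> P) = 1}"
        by (rule weakly_balanced_boundary[OF G bal])
    qed (use elt_ends_props[OF G] in auto)
    moreover have "K \<subseteq> K0 \<union> F"
    proof
      fix x assume "x \<in> K"
      then obtain P where x: "x \<in> elts G" "P \<in> \<P>" "card (elt_ends G x \<inter> P) = 1" by (auto simp: K_def)
      moreover have "elt_ends G x \<inter> X \<inter> P = elt_ends G x \<inter> P" using \<P>(2) x(2) by blast
      moreover have "elt_ends G x \<inter> P \<noteq> {}" using x(3) by auto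
      then have "elt_ends G x \<inter> X \<noteq> {}" using \<P>(2) x(2) by blast
      ultimately have "card (elt_ends G x \<inter> X \<inter> P) = 1" "elt_ends G x \<inter> X \<noteq> {}" by simp_all
      then show "x \<in> K0 \<union> F" using x(1,2) unfolding K0_def Z0_def by blast
    qed
    then have "card K \<le> card (K0 \<union> F)"
      using finZ0 finF by (intro card_mono) (auto simp: K0_def)
    then have "card K \<le> card K0 + t" using card_Un_le[of K0 F] F(2) by linarith
    ultimately show ?thesis unfolding K0_def[symmetric] by (simp add: algebra_simps)
  qed
  obtain Z where Z: "Z \<subseteq> Z0" "card Z = t * card X"
    "\<And>X'. X' \<subseteq> X \<Longrightarrow> X' \<noteq> {} \<Longrightarrow>
      \<exists>v\<in>X'. card {x \<in> Z. v \<in> elt_ends G x \<inter> X \<and> elt_ends G x \<inter> X \<subseteq> X'} < 2 * t"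
    by (rule H.degenerate_selection[OF t cross]) simp_all
  show thesis
  proof (rule that)
    show "Z \<subseteq> elts G - F" using Z(1) by (auto simp: Z0_def)
    show "elt_ends G x \<inter> X \<noteq> {}" if "x \<in> Z" for x using that Z(1) by (auto simp: Z0_def)
    fix X' assume X': "X' \<subseteq> X" "X' \<noteq> {}"
    then obtain v where v: "v \<in> X'" "card {x \<in> Z. v \<in> elt_ends G x \<inter> X \<and> elt_ends G x \<inter> X \<subseteq> X'} < 2 * t"
      using Z(3) by blast
    have "v \<in> X" using v X' by auto
    then show "\<exists>v\<in>X'. card {x \<in> Z. v \<in> elt_ends G x \<and> elt_ends G x \<inter> X \<subseteq> X'} < 2 * t"
      using v by auto
  qed (rule Z(2))
qed

section \<open>Principal extension and moment curve\<close>

global_interpretation fvec: vector_space "\<lambda>(c::real) (f::'i \<Rightarrow> real) i. c * f i"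
  by standard (auto simp: fun_eq_iff algebra_simps)

lemma sum_fun_apply: "(\<Sum>x\<in>A. f x) i = (\<Sum>x\<in>A. f x i)" for f :: "'a \<Rightarrow> 'i \<Rightarrow> real"
  by (induction A rule: infinite_finite_induct) auto

text \<open>Matrix rows form an indexed family, while independence in a vector space speaks of sets.
  Injectivity is recorded separately, since a repeated row would disappear in the image.\<close>

lemma fvec_independent_family:
  fixes f :: "'a \<Rightarrow> 'i \<Rightarrow> real"
  assumes fin: "finite I"
    and zero: "\<And>c i. (\<And>j. (\<Sum>i\<in>I. c i * f i j) = 0) \<Longrightarrow> i \<in> I \<Longrightarrow> c i = 0"
  shows "inj_on f I" "fvec.independent (f ` I)"
proof -
  show inj: "inj_on f I"
  proof (rule inj_onI, rule ccontr)
    fix a b assume ab: "a \<in> I" "b \<in> I" "f a = f b" "a \<noteq> b"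
    define c where "c i = (if i = a then 1 else 0) - (if i = b then 1 else (0::real))" for i
    have "(\<Sum>i\<in>I. c i * f i j) = 0" for j
    proof -
      have "(\<Sum>i\<in>I. c i * f i j) = (\<Sum>i\<in>I. if i = a then f i j else 0) - (\<Sum>i\<in>I. if i = b then f i j else 0)"
        unfolding sum_subtractf[symmetric] by (intro sum.cong) (auto simp: c_def)
      then show ?thesis using ab fin by simp
    qed
    then have "c a = 0" using zero[of c a] ab by blast
    then show False using ab by (simp add: c_def)
  qed
  show "fvec.independent (f ` I)"
  proof (rule fvec.independent_if_scalars_zero)
    fix g x assume g: "(\<Sum>x\<in>f ` I. (\<lambda>i. g x * x i)) = 0" and x: "x \<in> f ` I"
    then obtain i where i: "i \<in> I" "x = f i" by auto
    have "(\<Sum>i\<in>I. g (f i) * f i j) = 0" for j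
      using fun_cong[OF g, of j] by (simp add: sum_fun_apply sum.reindex[OF inj])
    then show "g x = 0" using zero[of "\<lambda>i. g (f i)" i] i by blast
  qed (use fin in simp)
qed

lemma fvec_independent_familyD:
  fixes f :: "'a \<Rightarrow> 'i \<Rightarrow> real"
  assumes "finite I" "inj_on f I" "fvec.independent (f ` I)"
    and zero: "\<And>j. (\<Sum>i\<in>I. c i * f i j) = 0" and i: "i \<in> I"
  shows "c i = 0"
proof -
  define u where "u x = c (the_inv_into I f x)" for x
  have "(\<Sum>x\<in>f ` I. (\<lambda>j. u x * x j)) = 0"
  proof
    fix j
    show "(\<Sum>x\<in>f ` I. (\<lambda>j. u x * x j)) j = 0 j"
      using zero[of j] by (simp add: sum_fun_apply sum.reindex[OF assms(2)] u_def the_inv_into_f_f[OF assms(2)])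
  qed
  then have "u (f i) = 0"
    using fvec.independentD[OF assms(3), of "f ` I" u "f i"] assms(1) i by simp
  then show ?thesis using i by (simp add: u_def the_inv_into_f_f[OF assms(2)])
qed

lemma fvec_card_le_dim:
  assumes "finite S" "fvec.independent B" "B \<subseteq> fvec.span S"
  shows "finite B" "card B \<le> fvec.dim S"
proof -
  obtain C where C: "C \<subseteq> S" "fvec.independent C" "S \<subseteq> fvec.span C" "card C = fvec.dim S"
    using fvec.basis_exists .
  have "finite C" using C(1) assms(1) finite_subset by blast
  moreover have "B \<subseteq> fvec.span C"
    using assms(3) fvec.span_minimal[OF C(3)] fvec.subspace_span by blast
  ultimately have "finite B \<and> card B \<le> card C"
    by (rule fvec.independent_span_bound[OF _ assms(2)])
  then show "finite B" "card B \<le> fvec.dim S" using C(4) by simp_all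
qed

lemma fvec_dim_mono:
  assumes "finite T" "S \<subseteq> T"
  shows "fvec.dim S \<le> fvec.dim T"
proof -
  obtain C where C: "C \<subseteq> S" "fvec.independent C" "S \<subseteq> fvec.span C" "card C = fvec.dim S"
    using fvec.basis_exists .
  have "T \<subseteq> fvec.span T" by (rule fvec.span_superset)
  then have "C \<subseteq> fvec.span T" using assms(2) C(1) by blast
  then show ?thesis using fvec_card_le_dim(2)[OF assms(1) C(2)] C(4) by simp
qed

lemma fvec_dim_insert:
  assumes "finite S" "x \<notin> fvec.span S"
  shows "fvec.dim (insert x S) = fvec.dim S + 1"
proof -
  obtain C where C: "C \<subseteq> S" "fvec.independent C" "S \<subseteq> fvec.span C" "card C = fvec.dim S"
    using fvec.basis_exists .
  have finC: "finite C" using C(1) assms(1) finite_subset by blast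
  have xC: "x \<notin> fvec.span C" using assms(2) fvec.span_mono[OF C(1)] by blast
  then have "x \<notin> C" using fvec.span_base by blast
  have "card (insert x C) = fvec.dim (insert x S)"
  proof (rule fvec.basis_card_eq_dim)
    show "insert x C \<subseteq> insert x S" using C(1) by blast
    show "fvec.independent (insert x C)" using xC C(2) by (rule fvec.independent_insertI)
    show "insert x S \<subseteq> fvec.span (insert x C)"
      using C(3) fvec.span_mono[of C "insert x C"] fvec.span_base[of x "insert x C"] by blast
  qed
  then show ?thesis using finC \<open>x \<notin> C\<close> C(4) by simp
qed

text \<open>A real vector space is not a finite union of proper subspaces. If \<open>x\<close>
  avoids the earlier subspaces and \<open>y\<close> avoids \<open>W\<close>, no subspace of the list
  contains two points \<open>x + c y\<close>, for then it would contain both \<open>x\<close> and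
  \<open>y\<close>; hence some \<open>c\<close> works.\<close>

lemma fvec_avoid_subspaces:
  assumes "finite \<W>" "\<And>W. W \<in> \<W> \<Longrightarrow> fvec.subspace W \<and> \<not> U \<subseteq> W" "fvec.subspace U"
  shows "\<exists>x\<in>U. \<forall>W\<in>\<W>. x \<notin> W"
  using assms(1,2)
proof (induction rule: finite_induct)
  case empty
  then show ?case using fvec.subspace_0[OF assms(3)] by auto
next
  case (insert W \<W>)
  then obtain x where x: "x \<in> U" "\<forall>W\<in>\<W>. x \<notin> W" by auto
  obtain y where y: "y \<in> U" "y \<notin> W" using insert.prems by blast
  define z where "z c = x + (\<lambda>i. c * y i)" for c
  have inj: "c = c'" if W': "W' \<in> insert W \<W>" and c: "z c \<in> W'" "z c' \<in> W'" for W' c c'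
  proof (rule ccontr)
    assume ne: "c \<noteq> c'"
    have sub: "fvec.subspace W'" using insert.prems W' by blast
    have "z c - z c' \<in> W'" using c fvec.subspace_diff[OF sub] by blast
    then have "(\<lambda>i. inverse (c - c') * (z c - z c') i) \<in> W'" by (rule fvec.subspace_scale[OF sub])
    moreover have "(\<lambda>i. inverse (c - c') * (z c - z c') i) = y"
      using ne by (auto simp: z_def fun_eq_iff field_simps)
    ultimately have yW': "y \<in> W'" by simp
    have "z c - (\<lambda>i. c * y i) \<in> W'"
      using fvec.subspace_diff[OF sub c(1) fvec.subspace_scale[OF sub yW']] .
    then have "x \<in> W'" by (simp add: z_def)
    then show False using x y yW' W' by auto
  qed
  have "finite {c. z c \<in> W'}" if W': "W' \<in> insert W \<W>" for W'
  proof (cases "{c. z c \<in> W'} = {}")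
    case False
    then obtain c where "z c \<in> W'" by auto
    then have "{c. z c \<in> W'} \<subseteq> {c}" using inj[OF W'] by auto
    then show ?thesis using finite_subset by blast
  qed simp
  then have "finite (\<Union>W'\<in>insert W \<W>. {c. z c \<in> W'})" using insert.hyps by blast
  then obtain c where c: "c \<notin> (\<Union>W'\<in>insert W \<W>. {c. z c \<in> W'})"
    using infinite_UNIV_char_0[where 'a = real] ex_new_if_finite by blast
  have "z c \<in> U" unfolding z_def
    using x y fvec.subspace_add[OF assms(3)] fvec.subspace_scale[OF assms(3)] by blast
  then show ?case using c by auto
qed

section \<open>Adding free vectors by principal extension\<close>

text \<open>Vectors are placed one at a time, each in \<open>fvec.span (B v)\<close> and in general
  position with respect to the finitely many spans of \<open>R\<close> with some of the
  \<open>B v\<close>. The Rado-type rank condition survives each placement with \<open>s v\<close>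
  lowered by one.\<close>

lemma fvec_principal_extension:
  fixes B :: "'v \<Rightarrow> ('i \<Rightarrow> real) set"
  assumes V: "finite V" "\<And>v. v \<in> V \<Longrightarrow> finite (B v)" and R: "finite R"
    and rank: "\<And>Y. Y \<subseteq> V \<Longrightarrow> N \<le> fvec.dim (R \<union> (\<Union>v\<in>Y. B v)) + (\<Sum>v\<in>V - Y. s v)"
  shows "\<exists>q. (\<forall>v\<in>V. \<forall>j<s v. q v j \<in> fvec.span (B v)) \<and>
    N \<le> fvec.dim (R \<union> (\<lambda>(v, j). q v j) ` (SIGMA v:V. {..<s v}))"
  using R rank
proof (induction "\<Sum>v\<in>V. s v" arbitrary: s R)
  case 0
  then have s0: "\<forall>v\<in>V. s v = 0" using V(1) by simp
  have "N \<le> fvec.dim R" using 0(3)[of "{}"] 0(1) by simp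
  moreover have "(SIGMA v:V. {..<s v}) = {}" using s0 by auto
  ultimately show ?case using s0 by simp
next
  case (Suc n)
  then obtain v where v: "v \<in> V" "0 < s v"
    by (metis Zero_not_Suc gr0I sum.neutral)
  define S where "S Y = R \<union> (\<Union>v\<in>Y. B v)" for Y
  have finS: "finite (S Y)" if "Y \<subseteq> V" for Y
    using that V Suc.prems(1) finite_subset unfolding S_def by blast
  \<comment> \<open>Avoiding these subspaces means that \<open>x\<close> lies in
    \<open>fvec.span (S Y)\<close> only if the whole span of \<open>B v\<close> does.\<close>
  define \<W> where "\<W> = {W \<in> (\<lambda>Y. fvec.span (S Y)) ` Pow V. \<not> fvec.span (B v) \<subseteq> W}"
  have "finite \<W>" using V(1) by (simp add: \<W>_def)
  moreover have "fvec.subspace W \<and> \<not> fvec.span (B v) \<subseteq> W" if "W \<in> \<W>" for W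
    using that fvec.subspace_span by (auto simp: \<W>_def)
  ultimately obtain x where x: "x \<in> fvec.span (B v)" "\<forall>W\<in>\<W>. x \<notin> W"
    using fvec_avoid_subspaces[of \<W> "fvec.span (B v)", OF _ _ fvec.subspace_span] by blast
  define s' where "s' = s(v := s v - 1)"
  have sum': "(\<Sum>u\<in>A. s u) = (\<Sum>u\<in>A. s' u) + of_bool (v \<in> A)" if "A \<subseteq> V" for A
  proof (cases "v \<in> A")
    case True
    have "finite A" using that V(1) finite_subset by blast
    then have "(\<Sum>u\<in>A. s u) = s v + (\<Sum>u\<in>A - {v}. s u)" "(\<Sum>u\<in>A. s' u) = s' v + (\<Sum>u\<in>A - {v}. s' u)"
      using True by (simp_all add: sum.remove)
    moreover have "(\<Sum>u\<in>A - {v}. s u) = (\<Sum>u\<in>A - {v}. s' u)"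
      by (rule sum.cong) (auto simp: s'_def)
    moreover have "s v = s' v + 1" using v(2) by (simp add: s'_def)
    moreover have "of_bool (v \<in> A) = (1::nat)" using True by simp
    ultimately show ?thesis by linarith
  next
    case False
    then have "(\<Sum>u\<in>A. s u) = (\<Sum>u\<in>A. s' u)" by (intro sum.cong) (auto simp: s'_def)
    then show ?thesis using False by simp
  qed
  have "n = (\<Sum>v\<in>V. s' v)" using Suc.hyps(2) sum'[of V] v(1) by simp
  moreover have "finite (insert x R)" using Suc.prems(1) by simp
  moreover have "N \<le> fvec.dim (insert x R \<union> (\<Union>v\<in>Y. B v)) + (\<Sum>v\<in>V - Y. s' v)" if Y: "Y \<subseteq> V" for Y
  proof -
    have eq: "insert x R \<union> (\<Union>v\<in>Y. B v) = insert x (S Y)" by (simp add: S_def)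
    show ?thesis
    proof (cases "x \<in> fvec.span (S Y)")
      \<comment> \<open>The rank grows by one, which pays for the lowered
        \<open>s v\<close>.\<close>
      case False
      then have "fvec.dim (insert x (S Y)) = fvec.dim (S Y) + 1" using finS[OF Y] by (rule fvec_dim_insert[rotated])
      then show ?thesis using Suc.prems(2)[OF Y] sum'[of "V - Y"] unfolding eq S_def
        by (cases "v \<in> V - Y") auto
    next
      \<comment> \<open>Now \<open>B v\<close> is already spanned by \<open>S Y\<close>, so the rank
        condition for \<open>insert v Y\<close>, whose complement does not count \<open>v\<close>,
        gives the bound for \<open>Y\<close>.\<close>
      case True
      then have "fvec.span (S Y) \<notin> \<W>" using x(2) by blast
      then have BS: "fvec.span (B v) \<subseteq> fvec.span (S Y)" using Y by (auto simp: \<W>_def)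
      have "fvec.span (insert x (S Y)) = fvec.span (S Y)" using True by (rule fvec.span_redundant)
      then have dim: "fvec.dim (insert x (S Y)) = fvec.dim (S Y)" by (rule fvec.span_eq_dim)
      have "B v \<subseteq> fvec.span (S Y)" using BS fvec.span_superset by blast
      moreover have "S (insert v Y) = S Y \<union> B v" by (auto simp: S_def)
      ultimately have "S (insert v Y) \<subseteq> fvec.span (S Y)" "S Y \<subseteq> fvec.span (S (insert v Y))"
        using fvec.span_superset[of "S Y"] fvec.span_superset[of "S Y \<union> B v"] by simp_all
      then have "fvec.span (S (insert v Y)) = fvec.span (S Y)"
        by (simp add: fvec.span_eq)
      then have dimv: "fvec.dim (S (insert v Y)) = fvec.dim (S Y)" by (rule fvec.span_eq_dim)
      have "insert v Y \<subseteq> V" using v(1) Y by simp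
      then have "N \<le> fvec.dim (S (insert v Y)) + (\<Sum>u\<in>V - insert v Y. s u)"
        using Suc.prems(2)[of "insert v Y"] by (simp add: S_def)
      moreover have "(\<Sum>u\<in>V - insert v Y. s u) = (\<Sum>u\<in>V - insert v Y. s' u)"
        using sum'[of "V - insert v Y"] by simp
      moreover have "(\<Sum>u\<in>V - insert v Y. s' u) \<le> (\<Sum>u\<in>V - Y. s' u)"
        using V(1) by (intro sum_mono2) auto
      ultimately show ?thesis unfolding eq dim using dimv by linarith
    qed
  qed
  ultimately obtain q where q: "\<forall>v\<in>V. \<forall>j<s' v. q v j \<in> fvec.span (B v)"
    "N \<le> fvec.dim (insert x R \<union> (\<lambda>(v, j). q v j) ` (SIGMA v:V. {..<s' v}))"
    using Suc.hyps(1)[of s' "insert x R"] by blast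
  \<comment> \<open>The new vector takes the last index \<open>s v - 1\<close>, which is outside the
    range used by \<open>s'\<close>.\<close>
  define q' where "q' = q(v := (q v)(s v - 1 := x))"
  have idx: "(SIGMA u:V. {..<s u}) = insert (v, s v - 1) (SIGMA u:V. {..<s' u})"
    using v by (auto simp: s'_def split: if_splits)
  have "(\<lambda>(v, j). q' v j) ` (SIGMA u:V. {..<s' u}) = (\<lambda>(v, j). q v j) ` (SIGMA u:V. {..<s' u})"
    by (rule image_cong[OF refl]) (auto simp: q'_def s'_def)
  then have "R \<union> (\<lambda>(v, j). q' v j) ` (SIGMA u:V. {..<s u})
      = insert x R \<union> (\<lambda>(v, j). q v j) ` (SIGMA u:V. {..<s' u})"
    unfolding idx by (simp add: q'_def)
  moreover have "\<forall>u\<in>V. \<forall>j<s u. q' u j \<in> fvec.span (B u)"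
    using q(1) x(1) by (auto simp: q'_def s'_def)
  ultimately show ?case using q(2) by (intro exI[of _ q']) auto
qed

text \<open>Pair the relation with a polynomial of degree at most \<open>d\<close> that vanishes at
  \<open>x\<close> and at every \<open>\<eta> a\<close> with \<open>a \<noteq> e\<close>: only the
  term of \<open>e\<close> survives, with a nonzero factor.\<close>

lemma moment_curve_independent:
  fixes \<eta> :: "'a \<Rightarrow> real"
  assumes A: "finite A" "card A \<le> d" and inj: "inj_on \<eta> A" and ne: "\<And>a. a \<in> A \<Longrightarrow> \<eta> a \<noteq> x"
    and zero: "\<And>i. i < d \<Longrightarrow> (\<Sum>a\<in>A. c a * (x ^ Suc i - \<eta> a ^ Suc i)) = 0" and e: "e \<in> A"
  shows "c e = 0"
proof -
  define f where "f = [:- x, 1:] * (\<Prod>a\<in>A - {e}. [:- \<eta> a, 1:])"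
  have "degree f \<le> degree [:- x, 1:] + (\<Sum>a\<in>A - {e}. degree [:- \<eta> a, 1:])"
    unfolding f_def using degree_mult_le degree_prod_sum_le[of "A - {e}" "\<lambda>a. [:- \<eta> a, 1:]"] A(1)
    by (metis (no_types, lifting) add_left_mono comp_apply finite_Diff order_trans sum.cong)
  also have "\<dots> = card A" using card_Suc_Diff1[OF A(1) e] by simp
  finally have deg: "degree f \<le> d" using A(2) by simp
  have poly_f: "poly f z = (\<Sum>i\<le>d. coeff f i * z ^ i)" for z
    unfolding poly_altdef using deg by (intro sum.mono_neutral_left) (auto simp: coeff_eq_0)
  \<comment> \<open>Constant terms cancel in the difference, so only the exponents
    \<open>Suc i\<close> with \<open>i < d\<close> occur, which are those covered by
    \<open>zero\<close>.\<close>
  have diff: "poly f x - poly f z = (\<Sum>i<d. coeff f (Suc i) * (x ^ Suc i - z ^ Suc i))" for z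
  proof -
    have "poly f x - poly f z = (\<Sum>i\<in>{..<Suc d}. coeff f i * (x ^ i - z ^ i))"
      unfolding poly_f by (simp add: sum_subtractf[symmetric] right_diff_distrib lessThan_Suc_atMost)
    then show ?thesis unfolding sum.lessThan_Suc_shift by simp
  qed
  have "(\<Sum>a\<in>A. c a * (poly f x - poly f (\<eta> a))) =
      (\<Sum>i<d. coeff f (Suc i) * (\<Sum>a\<in>A. c a * (x ^ Suc i - \<eta> a ^ Suc i)))"
    unfolding diff sum_distrib_left by (subst sum.swap) (simp only: mult.left_commute)
  also have "\<dots> = 0" using zero by simp
  finally have "(\<Sum>a\<in>A. c a * (poly f x - poly f (\<eta> a))) = 0" .
  moreover have "poly f x = 0" by (simp add: f_def)
  ultimately have "(\<Sum>a\<in>A. c a * poly f (\<eta> a)) = 0"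
    by (simp add: sum_negf)
  moreover have "poly f (\<eta> a) = 0" if "a \<in> A - {e}" for a
    using that A(1) by (auto simp: f_def poly_prod)
  then have "(\<Sum>a\<in>A. c a * poly f (\<eta> a)) = c e * poly f (\<eta> e)"
    using A(1) e by (simp add: sum.remove)
  moreover have "poly f (\<eta> e) \<noteq> 0"
    using ne[OF e] inj e A(1) by (auto simp: f_def poly_prod inj_on_def)
  ultimately show ?thesis by simp
qed

text \<open>The witness \<open>\<epsilon>\<close> comes from a right inverse \<open>D\<close> of \<open>M\<close>: a matrix close to \<open>M\<close> times \<open>D\<close> is
  diagonally dominant.\<close>

lemma square_rows_independent_open:
  fixes M :: "'a \<Rightarrow> 'i \<Rightarrow> real"
  assumes fin: "finite X" "finite J" and square: "card X = card J"
    and indep: "\<forall>c. (\<forall>j\<in>J. (\<Sum>x\<in>X. c x * M x j) = 0) \<longrightarrow> (\<forall>x\<in>X. c x = 0)"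
  shows "\<exists>\<epsilon>>0. \<forall>M'. (\<forall>x\<in>X. \<forall>j\<in>J. \<bar>M' x j - M x j\<bar> \<le> \<epsilon>) \<longrightarrow>
    (\<forall>c. (\<forall>j\<in>J. (\<Sum>x\<in>X. c x * M' x j) = 0) \<longrightarrow> (\<forall>x\<in>X. c x = 0))"
proof -
  define f where "f x j = (if j \<in> J then M x j else 0)" for x j
  define unit :: "'i \<Rightarrow> 'i \<Rightarrow> real" where "unit j j' = of_bool (j' = j)" for j j'
  have zero: "c x = 0" if c: "\<And>j. (\<Sum>x\<in>X. c x * f x j) = 0" and x: "x \<in> X" for c x
  proof -
    have "(\<Sum>x\<in>X. c x * M x j) = 0" if "j \<in> J" for j
      using c[of j] that by (simp add: f_def)
    then show ?thesis using indep x by blast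
  qed
  have inj: "inj_on f X" and ind: "fvec.independent (f ` X)"
    using fvec_independent_family[OF fin(1), of f] zero by blast+
  have f_eq: "f x = (\<Sum>j\<in>J. (\<lambda>k. M x j * unit j k))" for x
  proof
    fix k
    have "(\<Sum>j\<in>J. M x j * unit j k) = (\<Sum>j\<in>J. if j = k then M x j else 0)"
      by (rule sum.cong) (auto simp: unit_def)
    then show "f x k = (\<Sum>j\<in>J. (\<lambda>k. M x j * unit j k)) k"
      using fin(2) by (simp add: sum_fun_apply f_def)
  qed
  have f_span: "f x \<in> fvec.span (unit ` J)" for x
    unfolding f_eq by (intro fvec.span_sum fvec.span_scale fvec.span_base) auto
  \<comment> \<open>A unit vector outside the span would give \<open>card J + 1\<close> independent
    vectors in a space spanned by \<open>card J\<close>; this is where \<open>square\<close>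
    enters.\<close>
  have unit_span: "unit j \<in> fvec.span (f ` X)" if j: "j \<in> J" for j
  proof (rule ccontr)
    assume no: "unit j \<notin> fvec.span (f ` X)"
    then have "fvec.independent (insert (unit j) (f ` X))" using ind by (rule fvec.independent_insertI)
    moreover have "insert (unit j) (f ` X) \<subseteq> fvec.span (unit ` J)"
      using f_span j fvec.span_base by blast
    ultimately have "card (insert (unit j) (f ` X)) \<le> card (unit ` J)"
      using fvec.independent_span_bound[of "unit ` J"] fin(2) by blast
    also have "\<dots> \<le> card J" using fin(2) by (rule card_image_le)
    finally have "card (insert (unit j) (f ` X)) \<le> card J" .
    moreover have "unit j \<notin> f ` X" using no fvec.span_base[of "unit j" "f ` X"] by blast
    ultimately show False using fin(1) card_image[OF inj] square by simp
  qed
  have "\<exists>D. \<forall>k. unit j k = (\<Sum>y\<in>X. D y * f y k)" if j: "j \<in> J" for j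
  proof -
    have "unit j \<in> range (\<lambda>u. \<Sum>v\<in>f ` X. (\<lambda>k. u v * v k))"
      using unit_span[OF j] by (simp add: fvec.span_finite fin(1))
    then obtain u where "unit j = (\<Sum>v\<in>f ` X. (\<lambda>k. u v * v k))" by blast
    then have "unit j k = (\<Sum>y\<in>X. u (f y) * f y k)" for k
      by (simp add: sum_fun_apply sum.reindex[OF inj])
    then show ?thesis by (intro exI[of _ "\<lambda>y. u (f y)"]) blast
  qed
  then have "\<exists>D. \<forall>j\<in>J. \<forall>k. unit j k = (\<Sum>y\<in>X. D j y * f y k)" by (intro bchoice) blast
  then obtain D where D: "\<And>j k. j \<in> J \<Longrightarrow> unit j k = (\<Sum>y\<in>X. D j y * f y k)" by blast
  \<comment> \<open>\<open>D\<close> was built so that \<open>D M\<close> is the identity. Then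
    \<open>(M D - I) M = 0\<close>, and independence of the rows gives
    \<open>M D = I\<close>.\<close>
  have MD: "(\<Sum>j\<in>J. M x j * D j y) = of_bool (x = y)" if x: "x \<in> X" and y: "y \<in> X" for x y
  proof -
    have "(\<Sum>y\<in>X. ((\<Sum>j\<in>J. M x j * D j y) - of_bool (x = y)) * f y k) = 0" for k
    proof -
      have "(\<Sum>y\<in>X. (\<Sum>j\<in>J. M x j * D j y) * f y k) = (\<Sum>j\<in>J. M x j * (\<Sum>y\<in>X. D j y * f y k))"
        unfolding sum_distrib_left sum_distrib_right by (subst sum.swap) (simp only: mult.assoc)
      also have "\<dots> = (\<Sum>j\<in>J. M x j * unit j k)" using D by (intro sum.cong) auto
      also have "\<dots> = f x k" using fun_cong[OF f_eq[of x], of k] by (simp add: sum_fun_apply)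
      finally have 1: "(\<Sum>y\<in>X. (\<Sum>j\<in>J. M x j * D j y) * f y k) = f x k" .
      have "(\<Sum>y\<in>X. of_bool (x = y) * f y k) = (\<Sum>y\<in>X. if x = y then f y k else 0)"
        by (rule sum.cong) auto
      then have 2: "(\<Sum>y\<in>X. of_bool (x = y) * f y k) = f x k" using fin(1) x by simp
      show ?thesis unfolding left_diff_distrib sum_subtractf 1 2 by simp
    qed
    then have "(\<Sum>j\<in>J. M x j * D j y) - of_bool (x = y) = 0" by (rule zero[OF _ y])
    then show ?thesis by simp
  qed
  define K where "K = (\<Sum>y\<in>X. \<Sum>j\<in>J. \<bar>D j y\<bar>)"
  have K: "0 \<le> K" by (simp add: K_def sum_nonneg)
  \<comment> \<open>Chosen so that \<open>\<epsilon> * K < 1\<close>; the summand 1 keeps the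
    denominator positive when \<open>K = 0\<close>.\<close>
  define \<epsilon> where "\<epsilon> = 1 / (2 * (K + 1))"
  have \<epsilon>: "0 < \<epsilon>" "\<epsilon> * K < 1" using K by (auto simp: \<epsilon>_def field_simps)
  show ?thesis
  proof (intro exI[of _ \<epsilon>] conjI \<epsilon>(1) allI impI ballI)
    fix M' :: "'a \<Rightarrow> 'i \<Rightarrow> real" and c :: "'a \<Rightarrow> real" and x
    assume close: "\<forall>x\<in>X. \<forall>j\<in>J. \<bar>M' x j - M x j\<bar> \<le> \<epsilon>"
      and c: "\<forall>j\<in>J. (\<Sum>x\<in>X. c x * M' x j) = 0" and x: "x \<in> X"
    define S where "S = (\<Sum>x\<in>X. \<bar>c x\<bar>)"
    have S0: "0 \<le> S" by (simp add: S_def sum_nonneg)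
    \<comment> \<open>A relation \<open>c M' = 0\<close> gives \<open>c = - c (M' - M) D\<close>,
      hence \<open>S \<le> S * \<epsilon> * K\<close> for the sum \<open>S\<close> of absolute
      values, and so \<open>S = 0\<close>.\<close>
    have "\<bar>c y\<bar> \<le> S * \<epsilon> * (\<Sum>j\<in>J. \<bar>D j y\<bar>)" if y: "y \<in> X" for y
    proof -
      have "(\<Sum>j\<in>J. (\<Sum>x\<in>X. c x * M x j) * D j y) = (\<Sum>x\<in>X. c x * (\<Sum>j\<in>J. M x j * D j y))"
        unfolding sum_distrib_left sum_distrib_right by (subst sum.swap) (simp only: mult.assoc)
      also have "\<dots> = (\<Sum>x\<in>X. if x = y then c x else 0)" using MD y by (intro sum.cong) auto
      also have "\<dots> = c y" using fin(1) y by simp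
      finally have "c y = - (\<Sum>j\<in>J. (\<Sum>x\<in>X. c x * (M' x j - M x j)) * D j y)"
        using c by (simp add: right_diff_distrib sum_subtractf left_diff_distrib sum_negf)
      then have "\<bar>c y\<bar> = \<bar>\<Sum>j\<in>J. (\<Sum>x\<in>X. c x * (M' x j - M x j)) * D j y\<bar>" by simp
      also have "\<dots> \<le> (\<Sum>j\<in>J. \<bar>(\<Sum>x\<in>X. c x * (M' x j - M x j)) * D j y\<bar>)" by (rule sum_abs)
      also have "\<dots> \<le> (\<Sum>j\<in>J. S * \<epsilon> * \<bar>D j y\<bar>)"
      proof (rule sum_mono)
        fix j assume j: "j \<in> J"
        have "\<bar>\<Sum>x\<in>X. c x * (M' x j - M x j)\<bar> \<le> (\<Sum>x\<in>X. \<bar>c x * (M' x j - M x j)\<bar>)" by (rule sum_abs)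
        also have "\<dots> \<le> (\<Sum>x\<in>X. \<bar>c x\<bar> * \<epsilon>)"
          using close j by (intro sum_mono) (auto simp: abs_mult intro!: mult_left_mono)
        finally have "\<bar>\<Sum>x\<in>X. c x * (M' x j - M x j)\<bar> \<le> S * \<epsilon>" by (simp add: S_def sum_distrib_right)
        then show "\<bar>(\<Sum>x\<in>X. c x * (M' x j - M x j)) * D j y\<bar> \<le> S * \<epsilon> * \<bar>D j y\<bar>"
          by (simp add: abs_mult mult_right_mono)
      qed
      finally show ?thesis by (simp add: sum_distrib_left)
    qed
    then have "S \<le> (\<Sum>y\<in>X. S * \<epsilon> * (\<Sum>j\<in>J. \<bar>D j y\<bar>))" unfolding S_def by (intro sum_mono) auto
    then have "S \<le> S * (\<epsilon> * K)" by (simp add: K_def sum_distrib_left mult.assoc)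
    then have "S * (1 - \<epsilon> * K) \<le> 0" by (simp add: algebra_simps)
    then have "S = 0" using \<epsilon>(2) S0 by (simp add: mult_le_0_iff)
    then show "c x = 0" using x fin(1) by (simp add: S_def sum_nonneg_eq_0_iff)
  qed
qed

section \<open>Density of generic frameworks\<close>

text \<open>Used twice, first for monomials and then for polynomials over them. For keys in a fixed
  finite set the map is determined by its restriction, and a countable set has countably many finite
  subsets.\<close>

lemma countable_poly_mapping:
  fixes A :: "'a set"
  assumes "countable A"
  shows "countable {p :: 'a \<Rightarrow>\<^sub>0 'b::{zero, countable}. Poly_Mapping.keys p \<subseteq> A}"
proof -
  have fin: "countable {p :: 'a \<Rightarrow>\<^sub>0 'b. Poly_Mapping.keys p \<subseteq> S}" if S: "finite S" for S
  proof (rule countable_image_inj_on)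
    let ?f = "\<lambda>p :: 'a \<Rightarrow>\<^sub>0 'b. restrict (Poly_Mapping.lookup p) S"
    have "countable (S \<rightarrow>\<^sub>E (UNIV :: 'b set))" using S by (intro countable_PiE) auto
    moreover have "?f ` {p. Poly_Mapping.keys p \<subseteq> S} \<subseteq> (S \<rightarrow>\<^sub>E UNIV)" by auto
    ultimately show "countable (?f ` {p. Poly_Mapping.keys p \<subseteq> S})" by (rule countable_subset[rotated])
    show "inj_on ?f {p. Poly_Mapping.keys p \<subseteq> S}"
    proof (rule inj_onI)
      fix p q assume p: "p \<in> {p. Poly_Mapping.keys p \<subseteq> S}" and q: "q \<in> {p. Poly_Mapping.keys p \<subseteq> S}"
        and eq: "?f p = ?f q"
      show "p = q"
      proof (rule poly_mapping_eqI)
        fix k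
        show "Poly_Mapping.lookup p k = Poly_Mapping.lookup q k"
        proof (cases "k \<in> S")
          case True
          then show ?thesis using fun_cong[OF eq, of k] by simp
        next
          case False
          then have "k \<notin> Poly_Mapping.keys p" "k \<notin> Poly_Mapping.keys q" using p q by auto
          then show ?thesis by (simp add: in_keys_iff)
        qed
      qed
    qed
  qed
  have "countable (\<Union>S\<in>{S. finite S \<and> S \<subseteq> A}. {p :: 'a \<Rightarrow>\<^sub>0 'b. Poly_Mapping.keys p \<subseteq> S})"
    using fin by (intro countable_UN countable_Collect_finite_subset assms) auto
  moreover have "{p. Poly_Mapping.keys p \<subseteq> A} \<subseteq> (\<Union>S\<in>{S. finite S \<and> S \<subseteq> A}. {p :: 'a \<Rightarrow>\<^sub>0 'b. Poly_Mapping.keys p \<subseteq> S})"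
  proof
    fix p :: "'a \<Rightarrow>\<^sub>0 'b" assume "p \<in> {p. Poly_Mapping.keys p \<subseteq> A}"
    then have "Poly_Mapping.keys p \<in> {S. finite S \<and> S \<subseteq> A}" "p \<in> {q. Poly_Mapping.keys q \<subseteq> Poly_Mapping.keys p}"
      by simp_all
    then show "p \<in> (\<Union>S\<in>{S. finite S \<and> S \<subseteq> A}. {p. Poly_Mapping.keys p \<subseteq> S})" by (rule UN_I)
  qed
  ultimately show ?thesis by (rule countable_subset[rotated])
qed

text \<open>Fix all variables but the \<open>i\<close>-th and regard \<open>P\<close> as a
  univariate polynomial \<open>Q\<close>. One of its coefficients is the value at \<open>x\<close>
  of a nonzero polynomial \<open>Pk\<close> in variables of \<open>I\<close>, so algebraic
  independence gives \<open>Q \<noteq> 0\<close>.\<close>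

lemma finite_rat_poly_roots:
  fixes P :: "('i \<Rightarrow>\<^sub>0 nat) \<Rightarrow>\<^sub>0 rat"
  assumes x: "alg_independent I x" and P: "P \<noteq> 0" "\<And>m. m \<in> Poly_Mapping.keys P \<Longrightarrow> Poly_Mapping.keys m \<subseteq> insert i I"
  shows "finite {y. rat_poly_eval (x(i := y)) P = 0}"
proof -
  let ?c = "\<lambda>m. (of_rat (Poly_Mapping.lookup P m) :: real)"
  define w where "w m = (\<Prod>j\<in>Poly_Mapping.keys m - {i}. x j ^ Poly_Mapping.lookup m j)" for m
  define Q where "Q = (\<Sum>m\<in>Poly_Mapping.keys P. monom (?c m * w m) (Poly_Mapping.lookup m i))"
  have eval: "poly Q y = rat_poly_eval (x(i := y)) P" for y
  proof -
    have "(\<Prod>j\<in>Poly_Mapping.keys m. (x(i := y)) j ^ Poly_Mapping.lookup m j) = w m * y ^ Poly_Mapping.lookup m i" for m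
    proof (cases "i \<in> Poly_Mapping.keys m")
      case True
      then have "(\<Prod>j\<in>Poly_Mapping.keys m. (x(i := y)) j ^ Poly_Mapping.lookup m j) =
        y ^ Poly_Mapping.lookup m i * (\<Prod>j\<in>Poly_Mapping.keys m - {i}. (x(i := y)) j ^ Poly_Mapping.lookup m j)"
        by (subst prod.remove[of _ i]) auto
      also have "(\<Prod>j\<in>Poly_Mapping.keys m - {i}. (x(i := y)) j ^ Poly_Mapping.lookup m j) = w m"
        unfolding w_def by (rule prod.cong) auto
      finally show ?thesis by simp
    next
      case False
      then have "(\<Prod>j\<in>Poly_Mapping.keys m. (x(i := y)) j ^ Poly_Mapping.lookup m j) = w m"
        unfolding w_def by (intro prod.cong) auto
      then show ?thesis using False by (simp add: in_keys_iff)
    qed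
    then show ?thesis by (simp add: Q_def rat_poly_eval_def poly_sum poly_monom mult.assoc)
  qed
  have "Q \<noteq> 0"
  proof -
    obtain m0 where m0: "m0 \<in> Poly_Mapping.keys P" using P(1) by (metis keys_eq_empty ex_in_conv)
    \<comment> \<open>An exponent of variable \<open>i\<close> that occurs in \<open>P\<close>. The
      monomials with this exponent stay distinct after deleting \<open>i\<close>, so nothing cancels
      in \<open>Pk\<close>.\<close>
    define k where "k = Poly_Mapping.lookup m0 i"
    define K where "K = {m \<in> Poly_Mapping.keys P. Poly_Mapping.lookup m i = k}"
    define strip where "strip m = Poly_Mapping.update i 0 m" for m :: "'i \<Rightarrow>\<^sub>0 nat"
    have strip: "Poly_Mapping.keys (strip m) = Poly_Mapping.keys m - {i}"
      "j \<noteq> i \<Longrightarrow> Poly_Mapping.lookup (strip m) j = Poly_Mapping.lookup m j" for m j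
      by (simp_all add: strip_def keys_update lookup_update)
    have inj: "inj_on strip K"
    proof (rule inj_onI, rule poly_mapping_eqI)
      fix m m' j assume "m \<in> K" "m' \<in> K" "strip m = strip m'"
      then show "Poly_Mapping.lookup m j = Poly_Mapping.lookup m' j"
        using strip(2)[of j m] strip(2)[of j m'] by (cases "j = i") (auto simp: K_def)
    qed
    have finK: "finite K" by (simp add: K_def)
    define Pk where "Pk = (\<Sum>m\<in>K. Poly_Mapping.single (strip m) (Poly_Mapping.lookup P m))"
    have lookup_Pk: "Poly_Mapping.lookup Pk n = (\<Sum>m\<in>K. if strip m = n then Poly_Mapping.lookup P m else 0)" for n
      by (simp add: Pk_def lookup_sum lookup_single when_def)
    have lookup_strip: "Poly_Mapping.lookup Pk (strip m) = Poly_Mapping.lookup P m" if "m \<in> K" for m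
    proof -
      have "Poly_Mapping.lookup Pk (strip m) = (\<Sum>m'\<in>K. if m' = m then Poly_Mapping.lookup P m' else 0)"
        unfolding lookup_Pk by (rule sum.cong) (use inj that in \<open>auto simp: inj_on_def\<close>)
      then show ?thesis using finK that by simp
    qed
    have keys_Pk: "Poly_Mapping.keys Pk = strip ` K"
    proof
      show "Poly_Mapping.keys Pk \<subseteq> strip ` K"
      proof
        fix n assume "n \<in> Poly_Mapping.keys Pk"
        then have "(\<Sum>m\<in>K. if strip m = n then Poly_Mapping.lookup P m else 0) \<noteq> 0"
          by (simp add: in_keys_iff lookup_Pk)
        then obtain m where "m \<in> K" "(if strip m = n then Poly_Mapping.lookup P m else 0) \<noteq> 0"
          by (rule sum.not_neutral_contains_not_neutral)
        then show "n \<in> strip ` K" by (auto split: if_splits)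
      qed
      show "strip ` K \<subseteq> Poly_Mapping.keys Pk"
        using lookup_strip by (auto simp: in_keys_iff K_def)
    qed
    have "m0 \<in> K" using m0 by (simp add: K_def k_def)
    then have "Pk \<noteq> 0" using keys_Pk by auto
    moreover have "Poly_Mapping.keys m \<subseteq> I" if "m \<in> Poly_Mapping.keys Pk" for m
      using that P(2) strip(1) unfolding keys_Pk K_def by fastforce
    ultimately have "rat_poly_eval x Pk \<noteq> 0" using x by (auto simp: alg_independent_def)
    moreover have "rat_poly_eval x Pk = (\<Sum>m\<in>K. ?c m * w m)"
      unfolding rat_poly_eval_def keys_Pk sum.reindex[OF inj] comp_def
    proof (rule sum.cong[OF refl])
      fix m assume m: "m \<in> K"
      have "(\<Prod>j\<in>Poly_Mapping.keys (strip m). x j ^ Poly_Mapping.lookup (strip m) j) = w m"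
        unfolding w_def strip(1) by (rule prod.cong) (auto simp: strip(2))
      then show "of_rat (Poly_Mapping.lookup Pk (strip m)) *
          (\<Prod>j\<in>Poly_Mapping.keys (strip m). x j ^ Poly_Mapping.lookup (strip m) j) = ?c m * w m"
        using lookup_strip[OF m] by simp
    qed
    moreover have "coeff Q k = (\<Sum>m\<in>K. ?c m * w m)"
      unfolding Q_def coeff_sum K_def by (subst sum.inter_filter) (auto intro!: sum.cong)
    ultimately show ?thesis by auto
  qed
  then have "finite {y. poly Q y = 0}" by (rule poly_roots_finite)
  then show ?thesis by (simp add: eval)
qed

text \<open>Coordinates are chosen one after another. Countably many polynomials with finitely many
  roots each exclude only countably many values, and the interval about \<open>x i\<close> is
  uncountable.\<close>

lemma alg_independent_dense:
  fixes x :: "'i \<Rightarrow> real"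
  assumes "finite I" "0 < \<epsilon>"
  shows "\<exists>y. alg_independent I y \<and> (\<forall>i\<in>I. \<bar>y i - x i\<bar> < \<epsilon>)"
  using assms(1)
proof (induction rule: finite_induct)
  case empty
  have "rat_poly_eval x P \<noteq> 0" if P: "P \<noteq> 0" "\<forall>m\<in>Poly_Mapping.keys P. Poly_Mapping.keys m \<subseteq> {}" for P :: "('i \<Rightarrow>\<^sub>0 nat) \<Rightarrow>\<^sub>0 rat"
  proof -
    have "Poly_Mapping.keys P \<subseteq> {0}" using P(2) by auto
    moreover have "Poly_Mapping.keys P \<noteq> {}" using P(1) by simp
    ultimately have keys: "Poly_Mapping.keys P = {0}" by blast
    then have "Poly_Mapping.lookup P 0 \<noteq> 0" by (metis in_keys_iff insertI1)
    then show ?thesis by (simp add: rat_poly_eval_def keys)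
  qed
  then show ?case by (auto simp: alg_independent_def)
next
  case (insert i I)
  then obtain y where y: "alg_independent I y" "\<forall>j\<in>I. \<bar>y j - x j\<bar> < \<epsilon>" by blast
  define \<P> where "\<P> = {P :: ('i \<Rightarrow>\<^sub>0 nat) \<Rightarrow>\<^sub>0 rat. P \<noteq> 0 \<and> (\<forall>m\<in>Poly_Mapping.keys P. Poly_Mapping.keys m \<subseteq> insert i I)}"
  have "countable {m :: 'i \<Rightarrow>\<^sub>0 nat. Poly_Mapping.keys m \<subseteq> insert i I}"
    using insert.hyps(1) by (intro countable_poly_mapping countable_finite) simp
  then have "countable {P :: ('i \<Rightarrow>\<^sub>0 nat) \<Rightarrow>\<^sub>0 rat. Poly_Mapping.keys P \<subseteq> {m. Poly_Mapping.keys m \<subseteq> insert i I}}"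
    by (rule countable_poly_mapping)
  then have "countable \<P>" by (rule countable_subset[rotated]) (auto simp: \<P>_def)
  moreover have "countable {z. rat_poly_eval (y(i := z)) P = 0}" if "P \<in> \<P>" for P
    using that finite_rat_poly_roots[OF y(1), of P i] by (auto simp: \<P>_def intro: countable_finite)
  ultimately have "countable (\<Union>P\<in>\<P>. {z. rat_poly_eval (y(i := z)) P = 0})" (is "countable ?bad")
    by (rule countable_UN)
  moreover have "uncountable {x i - \<epsilon><..<x i + \<epsilon>}" using assms(2) by (simp add: uncountable_open_interval)
  ultimately have "\<not> {x i - \<epsilon><..<x i + \<epsilon>} \<subseteq> ?bad" using countable_subset by blast
  then obtain z where z: "z \<in> {x i - \<epsilon><..<x i + \<epsilon>}" "\<forall>P\<in>\<P>. rat_poly_eval (y(i := z)) P \<noteq> 0"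
    by blast
  have "alg_independent (insert i I) (y(i := z))" using z(2) by (auto simp: alg_independent_def \<P>_def)
  moreover have "\<forall>j\<in>insert i I. \<bar>(y(i := z)) j - x j\<bar> < \<epsilon>" using z(1) y(2) by (auto simp: abs_less_iff)
  ultimately show ?case by blast
qed

section \<open>Rigidity\<close>

text \<open>Entries outside the finitely many columns are set to zero, so that a relation on these
  columns is a relation between functions.\<close>

definition row_vec :: "nat \<Rightarrow> ('v, 'l) looped_graph \<Rightarrow> ('v \<Rightarrow> nat \<Rightarrow> real) \<Rightarrow> ('l \<Rightarrow> nat \<Rightarrow> real) \<Rightarrow>
    ('v, 'l) elt \<Rightarrow> 'v \<times> nat \<Rightarrow> real" where
  "row_vec d G p q x j = (if j \<in> verts G \<times> {..<d} then rigidity_matrix G p q x j else 0)"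

text \<open>As an additional row, \<open>unit_vec (v, i)\<close> pins coordinate \<open>i\<close> of
  \<open>v\<close>.\<close>

definition unit_vec :: "'i \<Rightarrow> 'i \<Rightarrow> real" where
  "unit_vec j k = of_bool (k = j)"

lemma in_span_unit_vec:
  assumes "finite J" "\<And>k. k \<notin> J \<Longrightarrow> f k = 0"
  shows "f \<in> fvec.span (unit_vec ` J)"
proof -
  have "f = (\<Sum>j\<in>J. (\<lambda>k. f j * unit_vec j k))"
  proof
    fix k
    have "(\<Sum>j\<in>J. f j * unit_vec j k) = (\<Sum>j\<in>J. if j = k then f j else 0)"
      by (rule sum.cong) (auto simp: unit_vec_def)
    then show "f k = (\<Sum>j\<in>J. (\<lambda>k. f j * unit_vec j k)) k"
      using assms by (simp add: sum_fun_apply)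
  qed
  also have "\<dots> \<in> fvec.span (unit_vec ` J)"
    by (intro fvec.span_sum fvec.span_scale fvec.span_base) auto
  finally show ?thesis .
qed

lemma span_unit_vec_vanishes:
  assumes "f \<in> fvec.span (unit_vec ` J)" "k \<notin> J"
  shows "f k = 0"
  using assms(1)
proof (induction rule: fvec.span_induct_alt)
  case (step c x y)
  then show ?case using assms(2) by (auto simp: unit_vec_def)
qed simp

lemma independent_card_le:
  assumes "finite J" "fvec.independent C" "\<And>f k. f \<in> C \<Longrightarrow> k \<notin> J \<Longrightarrow> f k = 0"
  shows "card C \<le> card J"
proof -
  have "C \<subseteq> fvec.span (unit_vec ` J)" using assms(1,3) in_span_unit_vec by blast
  then have "card C \<le> card (unit_vec ` J)"
    using fvec.independent_span_bound[of "unit_vec ` J" C] assms(1,2) by blast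
  also have "\<dots> \<le> card J" using assms(1) by (rule card_image_le)
  finally show ?thesis .
qed

lemma edge_other_end:
  assumes "looped_simple_graph G" "e \<in> edges G" "v \<in> e"
  obtains w where "e = {v, w}" "w \<noteq> v" "(THE w. e = {v, w}) = w" "v \<in> verts G" "w \<in> verts G"
proof -
  have "card e = 2" and sub: "e \<subseteq> verts G" using assms by (auto simp: looped_simple_graph_def)
  then obtain a b where "e = {a, b}" "a \<noteq> b" by (auto simp: card_2_iff)
  then obtain w where w: "e = {v, w}" "w \<noteq> v" using assms(3) by (cases "v = a") auto
  have "(THE w. e = {v, w}) = w" by (rule the_equality) (use w in \<open>auto simp: doubleton_eq_iff\<close>)
  then show thesis using that[of w] w sub by auto
qed

lemma rows_independent_row_vec:
  assumes "finite X" "rows_independent d G p q X"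
  shows "inj_on (row_vec d G p q) X" "fvec.independent (row_vec d G p q ` X)"
proof -
  have "c x = 0" if c: "\<And>j. (\<Sum>x\<in>X. c x * row_vec d G p q x j) = 0" and x: "x \<in> X" for c x
  proof -
    have "(\<Sum>x\<in>X. c x * rigidity_matrix G p q x j) = 0" if "j \<in> verts G \<times> {..<d}" for j
      using c[of j] that by (simp add: row_vec_def)
    then show ?thesis using assms(2) x unfolding rows_independent_def by blast
  qed
  then show "inj_on (row_vec d G p q) X" "fvec.independent (row_vec d G p q ` X)"
    using fvec_independent_family[OF assms(1), of "row_vec d G p q"] by blast+
qed

text \<open>A special position suffices. A basis chosen among the rows is as large as the number of
  columns, so it is square and stays independent under small perturbations, and some perturbation in
  that range is generic.\<close>

theorem lc_rigid_if_rows_span: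
  fixes G :: "('v, 'l) looped_graph"
  assumes G: "looped_simple_graph G"
    and span: "d * card (verts G) \<le> fvec.dim (row_vec d G p q ` elts G)"
  shows "lc_rigid d G"
proof -
  define J where "J = verts G \<times> {..<d}"
  have finV: "finite (verts G)" and finL: "finite (loops G)" using G by (auto simp: looped_simple_graph_def)
  have finJ: "finite J" and cardJ: "card J = d * card (verts G)"
    using finV by (simp_all add: J_def card_cartesian_product mult.commute)
  have finE: "finite (elts G)" by (rule finite_elts[OF G])
  have upper: "card X \<le> card J" if X: "finite X" "rows_independent d G p' q' X" for X p' q'
  proof -
    have "card X = card (row_vec d G p' q' ` X)"
      using rows_independent_row_vec(1)[OF X] by (simp add: card_image)
    also have "\<dots> \<le> card J"
      by (rule independent_card_le[OF finJ rows_independent_row_vec(2)[OF X]]) (auto simp: row_vec_def J_def split: if_splits)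
    finally show ?thesis .
  qed
  obtain C where C: "C \<subseteq> row_vec d G p q ` elts G" "fvec.independent C"
    "row_vec d G p q ` elts G \<subseteq> fvec.span C" "card C = fvec.dim (row_vec d G p q ` elts G)"
    using fvec.basis_exists .
  obtain X where X: "X \<subseteq> elts G" "inj_on (row_vec d G p q) X" "C = row_vec d G p q ` X"
    using C(1) by (meson subset_image_inj)
  have finX: "finite X" using X(1) finE finite_subset by blast
  have "card C \<le> card J"
    by (rule independent_card_le[OF finJ C(2)]) (use X(3) in \<open>auto simp: row_vec_def J_def split: if_splits\<close>)
  then have cardX: "card X = card J"
    using span C(4) cardJ card_image[OF X(2)] X(3) by simp
  have indep: "\<forall>c. (\<forall>j\<in>J. (\<Sum>x\<in>X. c x * rigidity_matrix G p q x j) = 0) \<longrightarrow> (\<forall>x\<in>X. c x = 0)"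
  proof (intro allI impI ballI)
    fix c x assume c: "\<forall>j\<in>J. (\<Sum>x\<in>X. c x * rigidity_matrix G p q x j) = 0" and x: "x \<in> X"
    have "fvec.independent (row_vec d G p q ` X)" using C(2) X(3) by simp
    moreover have "(\<Sum>x\<in>X. c x * row_vec d G p q x j) = 0" for j
      using c by (cases "j \<in> J") (simp_all add: row_vec_def flip: J_def)
    ultimately show "c x = 0" using fvec_independent_familyD[OF finX X(2) _ _ x] by blast
  qed
  obtain \<epsilon> where \<epsilon>: "0 < \<epsilon>"
    "\<forall>M'. (\<forall>x\<in>X. \<forall>j\<in>J. \<bar>M' x j - rigidity_matrix G p q x j\<bar> \<le> \<epsilon>) \<longrightarrow>
      (\<forall>c. (\<forall>j\<in>J. (\<Sum>x\<in>X. c x * M' x j) = 0) \<longrightarrow> (\<forall>x\<in>X. c x = 0))"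
    using square_rows_independent_open[OF finX finJ cardX indep] by (elim exE conjE)
  define I where "I = (verts G <+> loops G) \<times> {..<d}"
  have "finite I" using finV finL by (simp add: I_def)
  \<comment> \<open>Half of \<open>\<epsilon>\<close> is taken because an edge entry is a difference
    of two perturbed coordinates.\<close>
  then obtain y where y: "alg_independent I y"
    "\<And>k. k \<in> I \<Longrightarrow> \<bar>y k - (\<lambda>(a, i). case_sum p q a i) k\<bar> < \<epsilon> / 2"
    using alg_independent_dense[of I "\<epsilon> / 2" "\<lambda>(a, i). case_sum p q a i"] \<epsilon>(1) by (metis half_gt_zero)
  define p' where "p' v i = y (Inl v, i)" for v i
  define q' where "q' l i = y (Inr l, i)" for l i
  have "(\<lambda>(a, i). case_sum p' q' a i) = y"
    by (auto simp: fun_eq_iff p'_def q'_def split: sum.split)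
  then have gen: "generic d G p' q'" using y(1) by (simp add: generic_def I_def)
  have p': "\<bar>p' v i - p v i\<bar> < \<epsilon> / 2" if "v \<in> verts G" "i < d" for v i
    using y(2)[of "(Inl v, i)"] that by (simp add: I_def p'_def InlI)
  have q': "\<bar>q' l i - q l i\<bar> < \<epsilon> / 2" if "l \<in> loops G" "i < d" for l i
    using y(2)[of "(Inr l, i)"] that by (simp add: I_def q'_def InrI)
  have close: "\<bar>rigidity_matrix G p' q' x j - rigidity_matrix G p q x j\<bar> \<le> \<epsilon>"
    if x: "x \<in> X" and j: "j \<in> J" for x j
  proof -
    obtain v i where vi: "j = (v, i)" "v \<in> verts G" "i < d" using j by (auto simp: J_def)
    show ?thesis
    proof (cases x)
      case (Edge e)
      then have e: "e \<in> edges G" using x X(1) by (auto simp: elts_def)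
      show ?thesis
      proof (cases "v \<in> e")
        case True
        then obtain w where w: "(THE w. e = {v, w}) = w" "w \<in> verts G"
          using edge_other_end[OF G e] by metis
        have "\<bar>p' v i - p' w i - (p v i - p w i)\<bar> \<le> \<epsilon>"
          using p'[OF vi(2,3)] p'[OF w(2) vi(3)] by linarith
        then show ?thesis using True w(1) by (simp add: Edge vi(1))
      qed (use \<epsilon>(1) in \<open>simp add: Edge vi(1)\<close>)
    next
      case (Loop l)
      then have "l \<in> loops G" using x X(1) by (auto simp: elts_def)
      then show ?thesis using q'[of l i] vi(3) \<epsilon>(1) by (simp add: Loop vi(1))
    qed
  qed
  have "rows_independent d G p' q' X"
    unfolding rows_independent_def J_def[symmetric]
    using \<epsilon>(2) close by blast
  then have "lc_indep d G X" using gen X(1) by (auto simp: lc_indep_def)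
  then have "card J \<in> {card Y |Y. Y \<subseteq> elts G \<and> lc_indep d G Y}" 
    by (intro CollectI exI[of _ X]) (simp add: X(1) cardX)
  moreover have "card Y \<le> card J" if "lc_indep d G Y" for Y
    using that upper finE finite_subset unfolding lc_indep_def by metis
  moreover have "{card Y |Y. Y \<subseteq> elts G \<and> lc_indep d G Y} = card ` {Y. Y \<subseteq> elts G \<and> lc_indep d G Y}" by auto
  then have "finite {card Y |Y. Y \<subseteq> elts G \<and> lc_indep d G Y}" using finE by simp
  ultimately have "lc_rank d G (elts G) = card J"
    unfolding lc_rank_def by (intro Max_eqI) auto
  then show ?thesis by (simp add: lc_rigid_def cardJ)
qed

section \<open>Pinned frameworks on the moment curve\<close>

text \<open>A loop vector points from a private point of the curve to the point of its base, so loop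
  and edge rows have the same shape at a vertex. Let \<open>X'\<close> be the ends in
  \<open>X\<close> of the support of a nonzero relation. Some \<open>v\<close> in \<open>X'\<close>
  meets at most \<open>d\<close> supporting elements; their entries at \<open>v\<close> are
  independent, so none of them can be in the support.\<close>

lemma moment_rows_coeffs_zero:
  fixes G :: "('v, 'l) looped_graph" and \<xi> :: "'v + 'l \<Rightarrow> real"
  assumes G: "looped_simple_graph G"
    and \<xi>: "inj_on \<xi> (verts G <+> loops G)"
    and p: "\<And>v i. p v i = \<xi> (Inl v) ^ Suc i"
    and q: "\<And>l i. q l i = \<xi> (Inl (base G l)) ^ Suc i - \<xi> (Inr l) ^ Suc i"
    and X: "X \<subseteq> verts G" and Z: "Z \<subseteq> elts G" "\<And>x. x \<in> Z \<Longrightarrow> elt_ends G x \<inter> X \<noteq> {}"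
    and degenerate: "\<And>X'. X' \<subseteq> X \<Longrightarrow> X' \<noteq> {} \<Longrightarrow>
      \<exists>v\<in>X'. card {x \<in> Z. v \<in> elt_ends G x \<and> elt_ends G x \<inter> X \<subseteq> X'} \<le> d"
    and zero: "\<And>v i. v \<in> X \<Longrightarrow> i < d \<Longrightarrow> (\<Sum>x\<in>Z. c x * rigidity_matrix G p q x (v, i)) = 0"
    and x0: "x0 \<in> Z"
  shows "c x0 = 0"
proof (rule ccontr)
  assume "c x0 \<noteq> 0"
  define S where "S = {x \<in> Z. c x \<noteq> 0}"
  define X' where "X' = (\<Union>x\<in>S. elt_ends G x \<inter> X)"
  have finZ: "finite Z" using Z(1) finite_elts[OF G] finite_subset by blast
  have "x0 \<in> S" using x0 \<open>c x0 \<noteq> 0\<close> by (simp add: S_def)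
  then have "X' \<noteq> {}" using Z(2)[OF x0] by (auto simp: X'_def)
  moreover have "X' \<subseteq> X" by (auto simp: X'_def)
  ultimately obtain v where v: "v \<in> X'" "card {x \<in> Z. v \<in> elt_ends G x \<and> elt_ends G x \<inter> X \<subseteq> X'} \<le> d"
    using degenerate by blast
  define A where "A = {x \<in> S. v \<in> elt_ends G x}"
  have vX: "v \<in> X" using v(1) by (auto simp: X'_def)
  have finA: "finite A" using finZ by (simp add: A_def S_def)
  have "A \<subseteq> {x \<in> Z. v \<in> elt_ends G x \<and> elt_ends G x \<inter> X \<subseteq> X'}"
    by (auto simp: A_def S_def X'_def)
  then have "card A \<le> card {x \<in> Z. v \<in> elt_ends G x \<and> elt_ends G x \<inter> X \<subseteq> X'}"
    using finZ by (intro card_mono) auto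
  then have cardA: "card A \<le> d" using v(2) by simp
  \<comment> \<open>The label of the second curve point in the row of \<open>x\<close> at
    \<open>v\<close>: the neighbour for an edge, the loop itself for a loop. As edges are simple, it
    determines \<open>x\<close>.\<close>
  define other :: "('v, 'l) elt \<Rightarrow> 'v + 'l" where
    "other x = (case x of Edge e \<Rightarrow> Inl (THE w. e = {v, w}) | Loop l \<Rightarrow> Inr l)" for x
  have other: "other x \<in> verts G <+> loops G" "other x \<noteq> Inl v"
    "rigidity_matrix G p q x (v, i) = \<xi> (Inl v) ^ Suc i - \<xi> (other x) ^ Suc i"
    "x = (case other x of Inl w \<Rightarrow> Edge {v, w} | Inr l \<Rightarrow> Loop l)"
    if x: "x \<in> A" for x i
  proof -
    have xG: "x \<in> elts G" "v \<in> elt_ends G x" using x Z(1) by (auto simp: A_def S_def)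
    have "other x \<in> verts G <+> loops G \<and> other x \<noteq> Inl v \<and>
      rigidity_matrix G p q x (v, i) = \<xi> (Inl v) ^ Suc i - \<xi> (other x) ^ Suc i \<and>
      x = (case other x of Inl w \<Rightarrow> Edge {v, w} | Inr l \<Rightarrow> Loop l)"
    proof (cases x)
      case (Edge e)
      then have e: "e \<in> edges G" "v \<in> e" using xG by (auto simp: elts_def)
      obtain w where w: "e = {v, w}" "w \<noteq> v" "(THE w. e = {v, w}) = w" "w \<in> verts G"
        using edge_other_end[OF G e] by metis
      have ox: "other x = Inl w" using w(3) by (simp add: other_def Edge)
      show ?thesis using e(2) w(3) unfolding ox by (simp add: Edge p w(2,4) InlI flip: w(1))
    next
      case (Loop l)
      then show ?thesis using xG by (auto simp: other_def elts_def q)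
    qed
    then show "other x \<in> verts G <+> loops G" "other x \<noteq> Inl v"
      "rigidity_matrix G p q x (v, i) = \<xi> (Inl v) ^ Suc i - \<xi> (other x) ^ Suc i"
      "x = (case other x of Inl w \<Rightarrow> Edge {v, w} | Inr l \<Rightarrow> Loop l)" by blast+
  qed
  have v_in: "Inl v \<in> verts G <+> loops G" using vX X by auto
  have "c x = 0" if "x \<in> A" for x
  proof (rule moment_curve_independent[OF finA cardA, of "\<lambda>x. \<xi> (other x)" "\<xi> (Inl v)"])
    have "inj_on other A" by (rule inj_onI) (metis other(4))
    moreover have "inj_on \<xi> (other ` A)"
      using \<xi> other(1) by (meson image_subsetI inj_on_subset)
    ultimately have "inj_on (\<xi> \<circ> other) A" by (rule comp_inj_on)
    then show "inj_on (\<lambda>x. \<xi> (other x)) A" by (simp add: comp_def)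
    show "\<xi> (other x) \<noteq> \<xi> (Inl v)" if "x \<in> A" for x
      using inj_onD[OF \<xi> _ other(1)[OF that] v_in] other(2)[OF that] by blast
    show "(\<Sum>x\<in>A. c x * (\<xi> (Inl v) ^ Suc i - \<xi> (other x) ^ Suc i)) = 0" if i: "i < d" for i
    proof -
      have "(\<Sum>x\<in>A. c x * (\<xi> (Inl v) ^ Suc i - \<xi> (other x) ^ Suc i)) =
          (\<Sum>x\<in>A. c x * rigidity_matrix G p q x (v, i))"
        using other(3) by (intro sum.cong) auto
      \<comment> \<open>Outside \<open>A\<close> either the coefficient or the entry at
        \<open>v\<close> is zero.\<close>
      also have "\<dots> = (\<Sum>x\<in>Z. c x * rigidity_matrix G p q x (v, i))"
      proof (rule sum.mono_neutral_left[OF finZ])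
        show "A \<subseteq> Z" by (auto simp: A_def S_def)
        show "\<forall>x\<in>Z - A. c x * rigidity_matrix G p q x (v, i) = 0"
        proof
          fix x assume "x \<in> Z - A"
          then have "c x = 0 \<or> v \<notin> elt_ends G x" by (auto simp: A_def S_def)
          then show "c x * rigidity_matrix G p q x (v, i) = 0" by (cases x) auto
        qed
      qed
      also have "\<dots> = 0" by (rule zero[OF vX i])
      finally show ?thesis .
    qed
  qed (rule that)
  moreover obtain x where "x \<in> S" "v \<in> elt_ends G x" using v(1) by (auto simp: X'_def)
  ultimately show False by (auto simp: A_def S_def)
qed

text \<open>In the columns at \<open>X\<close> the pinning vectors vanish, so \<open>zero\<close>
  removes the coefficients on \<open>Z\<close>; what remains is a relation between distinct unit
  vectors.\<close>

lemma pinned_rank: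
  fixes G :: "('v, 'l) looped_graph"
  assumes G: "looped_simple_graph G"
    and X: "X \<subseteq> verts G" and Z: "Z \<subseteq> elts G"
    and zero: "\<And>c x. (\<And>v i. v \<in> X \<Longrightarrow> i < d \<Longrightarrow> (\<Sum>x\<in>Z. c x * rigidity_matrix G p q x (v, i)) = 0) \<Longrightarrow>
      x \<in> Z \<Longrightarrow> c x = 0"
  shows "card Z + d * card (verts G - X) \<le>
    fvec.dim (row_vec d G p q ` Z \<union> (\<Union>v\<in>verts G - X. (\<lambda>i. unit_vec (v, i)) ` {..<d}))"
proof -
  define Y where "Y = verts G - X"
  have finY: "finite Y" using G by (simp add: Y_def looped_simple_graph_def)
  have finZ: "finite Z" using Z finite_elts[OF G] finite_subset by blast
  define f where "f = case_sum (row_vec d G p q) unit_vec"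
  define I where "I = Z <+> Y \<times> {..<d}"
  have finI: "finite I" using finY finZ by (simp add: I_def)
  have key: "c k = 0" if c: "\<And>j. (\<Sum>k\<in>I. c k * f k j) = 0" and k: "k \<in> I" for c k
  proof -
    have split: "(\<Sum>x\<in>Z. c (Inl x) * row_vec d G p q x j) + (\<Sum>k\<in>Y \<times> {..<d}. c (Inr k) * unit_vec k j) = 0" for j
      using c[of j] finY finZ by (simp add: I_def sum.Plus f_def)
    have cZ: "c (Inl x) = 0" if "x \<in> Z" for x
    proof (rule zero[of "\<lambda>x. c (Inl x)", OF _ that])
      fix v i assume vi: "v \<in> X" "i < d"
      have "(\<Sum>k\<in>Y \<times> {..<d}. c (Inr k) * unit_vec k (v, i)) = 0"
        by (rule sum.neutral) (use vi in \<open>auto simp: unit_vec_def Y_def\<close>)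
      then have "(\<Sum>x\<in>Z. c (Inl x) * row_vec d G p q x (v, i)) = 0" using split[of "(v, i)"] by simp
      then show "(\<Sum>x\<in>Z. c (Inl x) * rigidity_matrix G p q x (v, i)) = 0"
        using vi X by (simp add: row_vec_def subset_iff)
    qed
    have "c (Inr j) = 0" if j: "j \<in> Y \<times> {..<d}" for j
    proof -
      have "(\<Sum>k\<in>Y \<times> {..<d}. c (Inr k) * unit_vec k j) = (\<Sum>k\<in>Y \<times> {..<d}. if k = j then c (Inr k) else 0)"
        by (rule sum.cong) (auto simp: unit_vec_def)
      then have "(\<Sum>k\<in>Y \<times> {..<d}. c (Inr k) * unit_vec k j) = c (Inr j)"
        using j finY by simp
      then show ?thesis using split[of j] cZ by simp
    qed
    then show ?thesis using cZ k by (auto simp: I_def)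
  qed
  have ind: "inj_on f I" "fvec.independent (f ` I)"
    using fvec_independent_family[OF finI, of f] key by blast+
  let ?S = "row_vec d G p q ` Z \<union> (\<Union>v\<in>Y. (\<lambda>i. unit_vec (v, i)) ` {..<d})"
  have "f ` I \<subseteq> ?S" by (auto simp: f_def I_def)
  then have "f ` I \<subseteq> fvec.span ?S" using fvec.span_superset by (rule order_trans)
  moreover have "finite ?S" using finZ finY by simp
  ultimately have "card (f ` I) \<le> fvec.dim ?S" using ind(2) fvec_card_le_dim(2) by blast
  moreover have "card (f ` I) = card Z + d * card Y"
    using ind(1) finZ finY by (simp add: card_image I_def card_Plus card_cartesian_product mult.commute)
  ultimately show ?thesis by (simp add: Y_def)
qed

section \<open>Combination of the selection, the moment curve and the principal extension\<close>

theorem theorem1p2: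
  fixes d t :: nat and G :: "('v, 'l) looped_graph" and F :: "('v, 'l) elt set"
  assumes "t \<ge> 1" and "d \<ge> 2" and "d \<ge> 2 * t - 1"
    and "looped_simple_graph G"
    and "weakly_balanced (2 * t) G"
    and "F \<subseteq> elts G" and "card F \<le> t"
  shows "lc_rigid d (del_elts (add_loops (d - t) G) (map_elt Inl ` F))"
proof -
  note G = \<open>looped_simple_graph G\<close>
  define H where "H = del_elts (add_loops (d - t) G) (map_elt Inl ` F)"
  let ?V = "verts G" and ?E = "elts G - F"
  have finV: "finite ?V" and finL: "finite (loops G)" using G by (auto simp: looped_simple_graph_def)
  have finE: "finite ?E" using finite_elts[OF G] by simp
  have map_elt_inj: "map_elt Inl x \<in> map_elt Inl ` F \<longleftrightarrow> x \<in> F" for x :: "('v, 'l) elt"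
    by (rule inj_image_mem_iff) (simp add: elt.inj_map)
  have H_verts: "verts H = ?V" by (simp add: H_def del_elts_def add_loops_def)
  have H_graph: "looped_simple_graph H"
    using G by (auto simp: H_def looped_simple_graph_def del_elts_def add_loops_def)
  have H_old: "map_elt Inl x \<in> elts H" if "x \<in> ?E" for x
    using that map_elt_inj[of x] by (cases x) (auto simp: H_def elts_def del_elts_def add_loops_def)
  have H_new: "Loop (Inr (v, j)) \<in> elts H" if "v \<in> ?V" "j < d - t" for v j
  proof -
    have "Loop (Inr (v, j)) \<noteq> map_elt Inl x" for x :: "('v, 'l) elt" by (cases x) auto
    then have "Loop (Inr (v, j)) \<notin> map_elt Inl ` F" by blast
    moreover have "Inr (v, j) \<in> loops G <+> ?V \<times> {..<d - t}" using that by (simp add: InrI)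
    ultimately show ?thesis by (simp add: H_def elts_def del_elts_def add_loops_def)
  qed
  obtain \<xi>0 :: "'v + 'l \<Rightarrow> nat" where "inj_on \<xi>0 (?V <+> loops G)"
    using finV finL finite_imp_inj_to_nat_seg[of "?V <+> loops G"] by auto
  then obtain \<xi> :: "'v + 'l \<Rightarrow> real" where \<xi>: "inj_on \<xi> (?V <+> loops G)"
    using that[of "\<lambda>a. real (\<xi>0 a)"] by (auto simp: inj_on_def)
  define p where "p v i = \<xi> (Inl v) ^ Suc i" for v i
  define q where "q l i = \<xi> (Inl (base G l)) ^ Suc i - \<xi> (Inr l) ^ Suc i" for l i
  define R where "R = row_vec d G p q ` ?E"
  define B where "B v = (\<lambda>i. unit_vec (v, i)) ` {..<d}" for v :: 'v
  \<comment> \<open>The rank condition of the principal extension: pinning \<open>Y\<close> gives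
    rank at least \<open>t * card X + d * card Y\<close>, and the new vectors account for the
    missing \<open>(d - t) * card X\<close>.\<close>
  have rank: "d * card ?V \<le> fvec.dim (R \<union> (\<Union>v\<in>Y. B v)) + (\<Sum>v\<in>?V - Y. d - t)" if Y: "Y \<subseteq> ?V" for Y
  proof -
    define X where "X = ?V - Y"
    have X: "X \<subseteq> ?V" "?V - X = Y" using Y by (auto simp: X_def)
    have "\<exists>Z\<subseteq>?E. card Z = t * card X \<and> (\<forall>x\<in>Z. elt_ends G x \<inter> X \<noteq> {}) \<and>
      (\<forall>X'\<subseteq>X. X' \<noteq> {} \<longrightarrow> (\<exists>v\<in>X'. card {x \<in> Z. v \<in> elt_ends G x \<and> elt_ends G x \<inter> X \<subseteq> X'} < 2 * t))"
      by (rule pinned_selection[OF G assms(5,1,6,7) X(1)]) blast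
    then obtain Z where Z: "Z \<subseteq> ?E" "card Z = t * card X" "\<forall>x\<in>Z. elt_ends G x \<inter> X \<noteq> {}"
      "\<forall>X'\<subseteq>X. X' \<noteq> {} \<longrightarrow> (\<exists>v\<in>X'. card {x \<in> Z. v \<in> elt_ends G x \<and> elt_ends G x \<inter> X \<subseteq> X'} < 2 * t)"
      by blast
    have Z_elts: "Z \<subseteq> elts G" using Z(1) by blast
    have deg: "\<exists>v\<in>X'. card {x \<in> Z. v \<in> elt_ends G x \<and> elt_ends G x \<inter> X \<subseteq> X'} \<le> d"
      if X': "X' \<subseteq> X" "X' \<noteq> {}" for X'
    proof -
      obtain v where "v \<in> X'" "card {x \<in> Z. v \<in> elt_ends G x \<and> elt_ends G x \<inter> X \<subseteq> X'} < 2 * t"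
        using Z(4) X' by blast
      \<comment> \<open>By \<open>2 * t - 1 \<le> d\<close>, a degree below \<open>2 * t\<close> is
        at most \<open>d\<close>, the number of curve differences that are independent at a
        vertex.\<close>
      then have "card {x \<in> Z. v \<in> elt_ends G x \<and> elt_ends G x \<inter> X \<subseteq> X'} \<le> d" using assms(3) by linarith
      then show ?thesis using \<open>v \<in> X'\<close> by blast
    qed
    have "card Z + d * card (?V - X) \<le> fvec.dim (row_vec d G p q ` Z \<union> (\<Union>v\<in>?V - X. (\<lambda>i. unit_vec (v, i)) ` {..<d}))"
    proof (rule pinned_rank[OF G X(1) Z_elts])
      fix c x assume "\<And>v i. v \<in> X \<Longrightarrow> i < d \<Longrightarrow> (\<Sum>x\<in>Z. c x * rigidity_matrix G p q x (v, i)) = 0" and "x \<in> Z"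
      then show "c x = 0"
        using moment_rows_coeffs_zero[OF G \<xi> p_def q_def X(1) Z_elts _ deg, of c x] Z(3) by blast
    qed
    also have "\<dots> \<le> fvec.dim (R \<union> (\<Union>v\<in>Y. B v))"
    proof (rule fvec_dim_mono)
      show "finite (R \<union> (\<Union>v\<in>Y. B v))"
        using finE Y finV finite_subset by (auto simp: R_def B_def)
      show "row_vec d G p q ` Z \<union> (\<Union>v\<in>?V - X. (\<lambda>i. unit_vec (v, i)) ` {..<d}) \<subseteq> R \<union> (\<Union>v\<in>Y. B v)"
        using Z(1) by (auto simp: X(2) R_def B_def)
    qed
    finally have "t * card X + d * card Y \<le> fvec.dim (R \<union> (\<Union>v\<in>Y. B v))" by (simp add: Z(2) X(2))
    moreover have "card ?V = card X + card Y"
      using Y finV card_Diff_subset[of Y ?V] card_mono[of ?V Y] finite_subset[of Y ?V] by (simp add: X_def)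
    \<comment> \<open>From \<open>t \<ge> 1\<close> and \<open>d \<ge> 2 * t - 1\<close> follows
      \<open>t \<le> d\<close>, so the natural subtraction is exact.\<close>
    moreover have "d = t + (d - t)" using assms(1,3) by simp
    then have "d * card X = t * card X + (d - t) * card X" by (metis add_mult_distrib)
    moreover have "(\<Sum>v\<in>?V - Y. d - t) = (d - t) * card X" by (simp add: X_def)
    ultimately show ?thesis by (simp add: algebra_simps)
  qed
  obtain q' where q': "\<forall>v\<in>?V. \<forall>j<d - t. q' v j \<in> fvec.span (B v)"
    "d * card ?V \<le> fvec.dim (R \<union> (\<lambda>(v, j). q' v j) ` (SIGMA v:?V. {..<d - t}))"
    using fvec_principal_extension[OF finV _ _ rank] finE by (auto simp: R_def B_def)
  \<comment> \<open>A new loop \<open>(v, j)\<close> carries the coordinates of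
    \<open>q' v j\<close> in the columns of \<open>v\<close>; old loops keep
    \<open>q\<close>.\<close>
  define q'' where "q'' = case_sum q (\<lambda>(v, j) i. q' v j (v, i))"
  have "row_vec d H p q'' (map_elt Inl x) = row_vec d G p q x" for x
  proof
    fix j :: "'v \<times> nat"
    obtain v i where "j = (v, i)" by (cases j)
    then show "row_vec d H p q'' (map_elt Inl x) j = row_vec d G p q x j"
      by (cases x) (auto simp: row_vec_def H_verts q''_def H_def del_elts_def add_loops_def)
  qed
  then have "R \<subseteq> row_vec d H p q'' ` elts H"
    using H_old unfolding R_def by (metis (no_types, lifting) image_iff image_subsetI)
  moreover have "q' v j \<in> row_vec d H p q'' ` elts H" if vj: "v \<in> ?V" "j < d - t" for v j
  proof -
    \<comment> \<open>Lying in the span of \<open>B v\<close>, the vector \<open>q' v j\<close>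
      vanishes outside the columns of \<open>v\<close>, so it is exactly the row of a loop at
      \<open>v\<close>.\<close>
    have supp: "q' v j k = 0" if "k \<notin> Pair v ` {..<d}" for k
    proof (rule span_unit_vec_vanishes[OF _ that])
      show "q' v j \<in> fvec.span (unit_vec ` Pair v ` {..<d})" using q'(1) vj by (simp add: B_def image_image)
    qed
    have "row_vec d H p q'' (Loop (Inr (v, j))) = q' v j"
    proof
      fix k :: "'v \<times> nat"
      obtain u i where k: "k = (u, i)" by (cases k)
      show "row_vec d H p q'' (Loop (Inr (v, j))) k = q' v j k"
        using vj(1) supp[of k] by (auto simp: k row_vec_def H_verts q''_def H_def del_elts_def add_loops_def)
    qed
    then show ?thesis using H_new[OF vj] by (metis imageI)
  qed
  ultimately have "R \<union> (\<lambda>(v, j). q' v j) ` (SIGMA v:?V. {..<d - t}) \<subseteq> row_vec d H p q'' ` elts H"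
    by auto
  then have "fvec.dim (R \<union> (\<lambda>(v, j). q' v j) ` (SIGMA v:?V. {..<d - t})) \<le>
      fvec.dim (row_vec d H p q'' ` elts H)"
    using finite_elts[OF H_graph] by (intro fvec_dim_mono) auto
  then have "d * card (verts H) \<le> fvec.dim (row_vec d H p q'' ` elts H)"
    using q'(2) unfolding H_verts by linarith
  then show ?thesis using lc_rigid_if_rows_span[OF H_graph] unfolding H_def by blast
qed

end
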